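(* The solution $(C',F')$ returned by the algorithm RobustFacLoc (described in the context, with its small constant parameter $\epsilon>0$) is a $(5+\epsilon)$-approximation to the Robust Facility Location problem; that is, $(C',F')$ is feasible and $$\mathrm{cost}(C',F')\le(5+\epsilon)\cdot\mathrm{cost}(C^*,F^* ),$$ where $(C^*,F^* )$ is an optimal solution of the given instance.
   Context: Robust Facility Location: the input is a set $F$ of facilities with opening costs $f_i\ge 0$ ($i\in F$), a set $C$ of clients, a metric $d$ on $F\cup C$, and an integer $p$ with $0\le p\le |C|$ (the coverage requirement). A feasible solution is a pair $(C',F')$ with $F'\subseteq F$, $C'\subseteq C$, $|C'|\ge p$; its cost is $\mathrm{cost}(C',F')=\sum_{i\in F'}f_i+\sum_{j\in C'}d(j,F')$, where $d(j,F')=\min_{i\in F'}d(i,j)$. An optimal solution minimizes the cost over all feasible solutions. Write $c_{ij}=d(i,j)$, $\ell=|C|-p$, and $n=|F|=|C|$. Every individual item of the input (opening costs, connection costs, etc.) is assumed to be representable in $O(\log n)$ bits. Algorithm RobustFacLoc, with a small constant $\epsilon>0$. For $t=0,\dots,O(\log n)$ (the number of iterations being $O(\log_{1+\epsilon}(f_{\max}/f_{\min}))$, where $f_{\max}$ is the largest opening cost and $f_{\min}$ the smallest non-zero opening cost) do the following. 1. Let $i_e\in F$ be the most expensive facility among those with opening cost in the range $[(1+\epsilon)^t,(1+\epsilon)^{t+1})$. Define modified opening costs: $f'_i=+\infty$ if $f_i>f_{i_e}$; $f'_i=0$ if $i=i_e$; $f'_i=f_i$ otherwise. Facilities with $f'_i=+\infty$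 are removed from consideration. 2. (Radius computation) For each facility $i$ compute $r_i\ge 0$ satisfying $f'_i=\sum_{j\in C}\max\{0,r_i-c_{ij}\}$. 3. (Greedy phase) Sort and renumber the facilities in non-decreasing order of $r_i$. Let $C'=\emptyset$, $F'=\emptyset$, $O'=C$, $F_0=\emptyset$. For $i=1,2,\dots$: if there is no facility in $F'$ within distance $2r_i$ from $i$, add $i$ to $F'$; set $F_i=F_{i-1}\cup\{i\}$; let $C_i$ be the set of clients within distance $r_i$ of some facility in $F_i$; set $C'\leftarrow C'\cup C_i$ and $O'\leftarrow O'\setminus C_i$; if $|O'|\le\ell$, break. 4. (Outlier determination) If $|O'|>\ell$, let $O_1\subseteq O'$ be a set of $|O'|-\ell$ clients that are closest to facilities in $F'$, and set $C'\leftarrow C'\cup O_1$, $O'\leftarrow O'\setminus O_1$. Else, if $|O'|<\ell$, let $O_2\subseteq C'$ be the set of $\ell-|O'|$ clients with largest distance to the open facilities $F'$, and set $C'\leftarrow C'\setminus O_2$, $O'\leftarrow O'\cup O_2$. 5. Let $(C'_t,F'_t)=(C',F')$. Return the solution $(C'_t,F'_t)$ of minimum cost over all $t$; it is denoted $(C',F')$ in the claim.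
   Formalization: Proved for ε ≤ 1; solutions must open at least one facility (matters only for p = 0); t ranges over all integers; if the optimal solution opens only zero-cost facilities, the algorithm must have an extra iteration for opening cost 0, as otherwise the claim fails. *)

theory Defs
  imports "HOL-Analysis.Analysis"
begin

section \<open>Robust facility location\<close>

locale rfl_instance = Metric_space "F \<union> C" d
  for F C :: "'a set" and d :: "'a \<Rightarrow> 'a \<Rightarrow> real" +
  fixes f :: "'a \<Rightarrow> real" and p :: nat
  assumes finite_facilities: "finite F"
    and finite_clients: "finite C"
    and card_eq: "card F = card C"
    and opening_cost_nonneg: "\<And>i. i \<in> F \<Longrightarrow> 0 \<le> f i"
    and coverage_le: "p \<le> card C"

text \<open>Only meaningful for nonempty finite \<open>F'\<close>.\<close>

definition dist_open :: "('a \<Rightarrow> 'a \<Rightarrow> real) \<Rightarrow> 'a set \<Rightarrow> 'a \<Rightarrow> real" where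
  "dist_open d F' j = Min ((\<lambda>i. d i j) ` F')"

definition rfl_cost ::
  "('a \<Rightarrow> 'a \<Rightarrow> real) \<Rightarrow> ('a \<Rightarrow> real) \<Rightarrow> 'a set \<Rightarrow> 'a set \<Rightarrow> real" where
  "rfl_cost d f C' F' = (\<Sum>i\<in>F'. f i) + (\<Sum>j\<in>C'. dist_open d F' j)"

text \<open>A solution opens at least one facility, so that the distance of a client to the open
  facilities is a minimum over a nonempty set. The condition \<open>F' \<noteq> {}\<close> matters only for
  \<open>p = 0\<close>: without it, opening nothing and serving nobody would have cost \<open>0\<close>, whereas the
  greedy phase below always opens a facility.\<close>

definition rfl_feasible :: "'a set \<Rightarrow> 'a set \<Rightarrow> nat \<Rightarrow> 'a set \<Rightarrow> 'a set \<Rightarrow> bool" where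
  "rfl_feasible F C p C' F' \<longleftrightarrow> F' \<subseteq> F \<and> F' \<noteq> {} \<and> C' \<subseteq> C \<and> p \<le> card C'"

definition rfl_optimal ::
  "'a set \<Rightarrow> 'a set \<Rightarrow> ('a \<Rightarrow> 'a \<Rightarrow> real) \<Rightarrow> ('a \<Rightarrow> real) \<Rightarrow> nat \<Rightarrow> 'a set \<Rightarrow> 'a set \<Rightarrow> bool" where
  "rfl_optimal F C d f p C' F' \<longleftrightarrow> rfl_feasible F C p C' F' \<and>
     (\<forall>C'' F''. rfl_feasible F C p C'' F'' \<longrightarrow> rfl_cost d f C' F' \<le> rfl_cost d f C'' F'')"


section \<open>The algorithm\<close>

text \<open>The algorithm leaves choices open (ties for the most expensive facility of a cost class,
  ties in the sorting, ties among the outliers, and the radius of a facility of modified cost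
  \<open>0\<close>). It is therefore modelled as the relation of all its possible results.\<close>

definition modified_cost :: "('a \<Rightarrow> real) \<Rightarrow> 'a \<Rightarrow> 'a \<Rightarrow> ereal" where
  "modified_cost f ie i = (if f i > f ie then \<infinity> else if i = ie then 0 else ereal (f i))"

definition is_radius ::
  "'a set \<Rightarrow> ('a \<Rightarrow> 'a \<Rightarrow> real) \<Rightarrow> ('a \<Rightarrow> real) \<Rightarrow> 'a \<Rightarrow> 'a \<Rightarrow> real \<Rightarrow> bool" where
  "is_radius C d f ie i s \<longleftrightarrow>
     0 \<le> s \<and> modified_cost f ie i = ereal (\<Sum>j\<in>C. max 0 (s - d i j))"

text \<open>The arguments are the facilities still to be processed, followed by the current values of
  \<open>C'\<close>, \<open>F'\<close>, \<open>O'\<close> and the set \<open>G\<close> of all facilities processed so far, opened or not. The result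
  is the final triple \<open>(C', F', O')\<close>.\<close>

fun greedy ::
  "'a set \<Rightarrow> ('a \<Rightarrow> 'a \<Rightarrow> real) \<Rightarrow> nat \<Rightarrow> ('a \<Rightarrow> real) \<Rightarrow> 'a list
    \<Rightarrow> 'a set \<Rightarrow> 'a set \<Rightarrow> 'a set \<Rightarrow> 'a set \<Rightarrow> 'a set \<times> 'a set \<times> 'a set" where
  "greedy C d l r [] C' F' O' G = (C', F', O')"
| "greedy C d l r (i # xs) C' F' O' G =
    (let F'' = (if \<exists>h\<in>F'. d h i \<le> 2 * r i then F' else insert i F');
         G' = insert i G;
         Ci = {j \<in> C. \<exists>h\<in>G'. d h j \<le> r i};
         C'' = C' \<union> Ci;
         O'' = O' - Ci
     in if card O'' \<le> l then (C'', F'', O'') else greedy C d l r xs C'' F'' O'' G')"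

text \<open>\<open>outlier_step d l F' C' O' C''\<close>: the outlier determination may turn the client set \<open>C'\<close>
  with outliers \<open>O'\<close> into \<open>C''\<close>.\<close>

definition outlier_step ::
  "('a \<Rightarrow> 'a \<Rightarrow> real) \<Rightarrow> nat \<Rightarrow> 'a set \<Rightarrow> 'a set \<Rightarrow> 'a set \<Rightarrow> 'a set \<Rightarrow> bool" where
  "outlier_step d l F' C' O' C'' \<longleftrightarrow>
    (if card O' > l then
       \<exists>O1 \<subseteq> O'. card O1 = card O' - l \<and>
         (\<forall>a\<in>O1. \<forall>b\<in>O' - O1. dist_open d F' a \<le> dist_open d F' b) \<and> C'' = C' \<union> O1
     else if card O' < l then
       \<exists>O2 \<subseteq> C'. card O2 = l - card O' \<and>
         (\<forall>a\<in>O2. \<forall>b\<in>C' - O2. dist_open d F' b \<le> dist_open d F' a) \<and> C'' = C' - O2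
     else C'' = C')"

text \<open>One iteration of the main loop, for the facilities with opening cost in \<open>R\<close>.\<close>

definition rfl_round ::
  "'a set \<Rightarrow> 'a set \<Rightarrow> ('a \<Rightarrow> 'a \<Rightarrow> real) \<Rightarrow> ('a \<Rightarrow> real) \<Rightarrow> nat \<Rightarrow> real set
    \<Rightarrow> 'a set \<Rightarrow> 'a set \<Rightarrow> bool" where
  "rfl_round F C d f p R Ct Ft \<longleftrightarrow>
    (\<exists>ie r xs C' O'.
       ie \<in> F \<and> f ie \<in> R \<and> (\<forall>i\<in>F. f i \<in> R \<longrightarrow> f i \<le> f ie) \<and>
       (\<forall>i\<in>F. modified_cost f ie i \<noteq> \<infinity> \<longrightarrow> is_radius C d f ie i (r i)) \<and>
       distinct xs \<and> set xs = {i \<in> F. modified_cost f ie i \<noteq> \<infinity>} \<and> sorted (map r xs) \<and>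
       greedy C d (card C - p) r xs {} {} C {} = (C', Ft, O') \<and>
       outlier_step d (card C - p) Ft C' O' Ct)"

text \<open>\<open>Some t\<close> stands for the class \<open>[(1+\<epsilon>)^t, (1+\<epsilon>)^(t+1))\<close>. The exponent is an integer, so that
  nonzero opening costs below \<open>1\<close> also lie in a class; if all nonzero costs are at least \<open>1\<close>, the
  classes with \<open>t < 0\<close> contain no facility. \<open>None\<close> stands for the facilities of opening cost \<open>0\<close>,
  which lie in no class of the first kind.\<close>

fun cost_class :: "real \<Rightarrow> int option \<Rightarrow> real set" where
  "cost_class \<epsilon> (Some t) = {(1 + \<epsilon>) powi t ..< (1 + \<epsilon>) powi (t + 1)}"
| "cost_class \<epsilon> None = {0}"

text \<open>An iteration is carried out only if some facility belongs to its class. The flag \<open>zr\<close> tells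
  whether there is also an iteration for the facilities of opening cost \<open>0\<close>.\<close>

definition rfl_iterations ::
  "'a set \<Rightarrow> ('a \<Rightarrow> real) \<Rightarrow> bool \<Rightarrow> real \<Rightarrow> int option set" where
  "rfl_iterations F f zr \<epsilon> =
     {t. (t = None \<longrightarrow> zr) \<and> (\<exists>i\<in>F. f i \<in> cost_class \<epsilon> t)}"

definition robust_fac_loc ::
  "'a set \<Rightarrow> 'a set \<Rightarrow> ('a \<Rightarrow> 'a \<Rightarrow> real) \<Rightarrow> ('a \<Rightarrow> real) \<Rightarrow> nat \<Rightarrow> bool \<Rightarrow> real
    \<Rightarrow> 'a set \<Rightarrow> 'a set \<Rightarrow> bool" where
  "robust_fac_loc F C d f p zr \<epsilon> C' F' \<longleftrightarrow>
    (\<exists>Ct Ft. (\<forall>t \<in> rfl_iterations F f zr \<epsilon>.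
                rfl_round F C d f p (cost_class \<epsilon> t) (Ct t) (Ft t)) \<and>
       (\<exists>t \<in> rfl_iterations F f zr \<epsilon>. C' = Ct t \<and> F' = Ft t \<and>
          (\<forall>s \<in> rfl_iterations F f zr \<epsilon>.
             rfl_cost d f (Ct t) (Ft t) \<le> rfl_cost d f (Ct s) (Ft s))))"


section \<open>The algorithm has a result\<close>

lemma ex_smallest_subset:
  fixes g :: "'a \<Rightarrow> real"
  assumes "finite A" "m \<le> card A"
  shows "\<exists>B\<subseteq>A. card B = m \<and> (\<forall>a\<in>B. \<forall>b\<in>A - B. g a \<le> g b)"
  using assms(2)
proof (induction m)
  case 0
  then show ?case by (intro exI[of _ "{}"]) auto
next
  case (Suc m)
  then obtain B where B: "B \<subseteq> A" "card B = m" "\<forall>a\<in>B. \<forall>b\<in>A - B. g a \<le> g b"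
    by auto
  have fB: "finite B" using B(1) assms(1) finite_subset by blast
  have "A - B \<noteq> {}"
    using B Suc.prems by (metis Diff_eq_empty_iff Suc_n_not_le_n subset_antisym)
  then obtain x where x: "x \<in> A - B" "\<forall>b\<in>A - B. g x \<le> g b"
    using arg_min_if_finite[of "A - B" g] assms(1) by (meson finite_Diff not_less)
  show ?case
  proof (intro exI[of _ "insert x B"] conjI)
    show "insert x B \<subseteq> A" using x B by auto
    show "card (insert x B) = Suc m" using x B fB by auto
    show "\<forall>a\<in>insert x B. \<forall>b\<in>A - insert x B. g a \<le> g b" using x B by auto
  qed
qed

lemma ex_radius:
  fixes g :: "'a \<Rightarrow> real"
  assumes "finite C" "C \<noteq> {}" "\<And>j. j \<in> C \<Longrightarrow> 0 \<le> g j" "0 \<le> c"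
  shows "\<exists>s\<ge>0. c = (\<Sum>j\<in>C. max 0 (s - g j))"
proof -
  let ?h = "\<lambda>s. \<Sum>j\<in>C. max 0 (s - g j)"
  obtain k where k: "k \<in> C" using assms by auto
  have 0: "?h 0 = 0" by (rule sum.neutral) (use assms in force)
  have "max 0 (c + g k - g k) \<le> ?h (c + g k)"
    by (rule member_le_sum[OF k]) (use assms in auto)
  then have 1: "c \<le> ?h (c + g k)" by simp
  have "\<exists>s. 0 \<le> s \<and> s \<le> c + g k \<and> ?h s = c"
    by (rule IVT') (use 0 1 assms k in \<open>auto intro!: continuous_intros\<close>)
  then show ?thesis by metis
qed

lemma greedy_partition:
  "greedy C d l r xs C' F' (C - C') G = (C'', F'', O'') \<Longrightarrow> C' \<subseteq> C \<Longrightarrow>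
     C'' \<subseteq> C \<and> O'' = C - C''"
proof (induction xs arbitrary: C' F' G)
  case (Cons i xs)
  define D where "D = {j \<in> C. \<exists>h\<in>insert i G. d h j \<le> r i}"
  define H where "H = (if \<exists>h\<in>F'. d h i \<le> 2 * r i then F' else insert i F')"
  have *: "C - C' - D = C - (C' \<union> D)" by auto
  have sub: "C' \<union> D \<subseteq> C" using Cons.prems(2) by (auto simp: D_def)
  have "(if card (C - (C' \<union> D)) \<le> l then (C' \<union> D, H, C - (C' \<union> D))
      else greedy C d l r xs (C' \<union> D) H (C - (C' \<union> D)) (insert i G)) = (C'', F'', O'')"
    using Cons.prems(1) unfolding greedy.simps Let_def D_def[symmetric] H_def[symmetric] *
    by assumption
  then show ?case
    using Cons.IH sub by (metis Pair_inject)
qed auto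

lemma ex_outlier_step:
  assumes "finite C" "C' \<subseteq> C" "O' = C - C'" "l \<le> card C"
  shows "\<exists>C''. outlier_step d l F' C' O' C''"
proof -
  have f: "finite C'" "finite O'" using assms finite_subset by auto
  have "card O' = card C - card C'"
    using assms f by (simp add: card_Diff_subset)
  then have le: "l - card O' \<le> card C'" using assms(4) by linarith
  consider "card O' > l" | "card O' < l" | "card O' = l" by linarith
  then show ?thesis
  proof cases
    case 1
    with ex_smallest_subset[OF f(2), of "card O' - l" "dist_open d F'"]
    show ?thesis unfolding outlier_step_def by auto
  next
    case 2
    with ex_smallest_subset[OF f(1) le, of "\<lambda>j. - dist_open d F' j"]
    show ?thesis unfolding outlier_step_def by auto
  qed (auto simp: outlier_step_def)
qed

context rfl_instance
begin

lemma ex_rfl_round: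
  assumes "i0 \<in> F" "f i0 \<in> R"
  shows "\<exists>Ct Ft. rfl_round F C d f p R Ct Ft"
proof -
  have C: "C \<noteq> {}" using assms card_eq finite_facilities by auto
  obtain ie where ie: "ie \<in> F" "f ie \<in> R" "\<forall>i\<in>F. f i \<in> R \<longrightarrow> f i \<le> f ie"
  proof -
    have "finite (f ` {i \<in> F. f i \<in> R})" "f ` {i \<in> F. f i \<in> R} \<noteq> {}"
      using finite_facilities assms by auto
    from Max_in[OF this] Max_ge[OF this(1)] that show ?thesis by fastforce
  qed
  have "\<exists>s. is_radius C d f ie i s" if "i \<in> F" "modified_cost f ie i \<noteq> \<infinity>" for i
  proof -
    have "\<exists>c\<ge>0. modified_cost f ie i = ereal c"
      using that opening_cost_nonneg by (auto simp: modified_cost_def zero_ereal_def)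
    then obtain c where c: "0 \<le> c" "modified_cost f ie i = ereal c" by auto
    show ?thesis
      using ex_radius[OF finite_clients C, of "d i" c] c nonneg by (auto simp: is_radius_def)
  qed
  then obtain r where r: "\<forall>i\<in>F. modified_cost f ie i \<noteq> \<infinity> \<longrightarrow> is_radius C d f ie i (r i)"
    by metis
  obtain ys where ys: "set ys = {i \<in> F. modified_cost f ie i \<noteq> \<infinity>}" "distinct ys"
    using finite_distinct_list[of "{i \<in> F. modified_cost f ie i \<noteq> \<infinity>}"] finite_facilities
    by auto
  define xs where "xs = sort_key r ys"
  have xs: "distinct xs" "set xs = {i \<in> F. modified_cost f ie i \<noteq> \<infinity>}" "sorted (map r xs)"
    using ys by (auto simp: xs_def)
  obtain C' F' O' where g: "greedy C d (card C - p) r xs {} {} C {} = (C', F', O')"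
    using prod_cases3 by blast
  then have "C' \<subseteq> C \<and> O' = C - C'"
    using greedy_partition[of C d "card C - p" r xs "{}" "{}" "{}"] by simp
  then obtain C'' where "outlier_step d (card C - p) F' C' O' C''"
    using ex_outlier_step[OF finite_clients] by (meson diff_le_self)
  with ie r xs g show ?thesis unfolding rfl_round_def by blast
qed

lemma ex_cost_class:
  assumes "0 < \<epsilon>" "0 < x"
  shows "\<exists>t. x \<in> cost_class \<epsilon> (Some t)"
proof -
  define t where "t = \<lfloor>log (1 + \<epsilon>) x\<rfloor>"
  have e: "1 + \<epsilon> > 1" using assms by simp
  have "real_of_int t \<le> log (1 + \<epsilon>) x" "log (1 + \<epsilon>) x < real_of_int (t + 1)"
    unfolding t_def by linarith+
  then have "(1 + \<epsilon>) powr real_of_int t \<le> x" "x < (1 + \<epsilon>) powr real_of_int (t + 1)"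
    using e assms(2) by (simp_all only: le_log_iff log_less_iff)
  moreover have "(1 + \<epsilon>) powr real_of_int k = (1 + \<epsilon>) powi k" for k
    using e by (intro powr_real_of_int') auto
  ultimately have "x \<in> cost_class \<epsilon> (Some t)"
    by (simp only: cost_class.simps atLeastLessThan_iff)
  then show ?thesis ..
qed

lemma finite_rfl_iterations:
  assumes "0 < \<epsilon>"
  shows "finite (rfl_iterations F f zr \<epsilon>)"
proof -
  have e: "1 + \<epsilon> > 1" using assms by simp
  have uniq: "s \<le> t"
    if "x \<in> cost_class \<epsilon> (Some s)" "x \<in> cost_class \<epsilon> (Some t)" for x s t
  proof (rule ccontr)
    assume "\<not> s \<le> t"
    then have "(1 + \<epsilon>) powi (t + 1) \<le> (1 + \<epsilon>) powi s"
      using e by (intro power_int_increasing) auto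
    with that show False by simp
  qed
  have "finite {t. x \<in> cost_class \<epsilon> t}" for x
  proof (cases "\<exists>t. x \<in> cost_class \<epsilon> (Some t)")
    case True
    then obtain t where t: "x \<in> cost_class \<epsilon> (Some t)" by blast
    have "{t. x \<in> cost_class \<epsilon> t} \<subseteq> {None, Some t}"
    proof
      fix s assume s: "s \<in> {t. x \<in> cost_class \<epsilon> t}"
      show "s \<in> {None, Some t}"
        using s t uniq by (cases s) (auto simp del: cost_class.simps intro: antisym)
    qed
    then show ?thesis by (rule finite_subset) simp
  next
    case False
    have "{t. x \<in> cost_class \<epsilon> t} \<subseteq> {None}"
    proof
      fix s assume "s \<in> {t. x \<in> cost_class \<epsilon> t}"
      with False show "s \<in> {None}" by (cases s) (auto simp del: cost_class.simps)
    qed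
    then show ?thesis by (rule finite_subset) simp
  qed
  moreover have "rfl_iterations F f zr \<epsilon> \<subseteq> (\<Union>i\<in>F. {t. f i \<in> cost_class \<epsilon> t})"
    by (auto simp: rfl_iterations_def)
  ultimately show ?thesis
    using finite_facilities by (auto intro: finite_subset)
qed

theorem ex_robust_fac_loc:
  assumes "0 < \<epsilon>" "F \<noteq> {}" "zr \<or> (\<exists>i\<in>F. 0 < f i)"
  shows "\<exists>C' F'. robust_fac_loc F C d f p zr \<epsilon> C' F'"
proof -
  let ?T = "rfl_iterations F f zr \<epsilon>"
  have ne: "?T \<noteq> {}"
  proof (cases "\<exists>i\<in>F. 0 < f i")
    case True
    then obtain i t where "i \<in> F" "f i \<in> cost_class \<epsilon> (Some t)"
      using ex_cost_class[OF assms(1)] by blast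
    then have "Some t \<in> ?T" unfolding rfl_iterations_def by blast
    then show ?thesis by blast
  next
    case False
    then obtain i where "i \<in> F" "f i = 0" zr
      using assms opening_cost_nonneg by (metis all_not_in_conv less_eq_real_def)
    then have "None \<in> ?T" unfolding rfl_iterations_def by auto
    then show ?thesis by blast
  qed
  have "\<forall>t\<in>?T. \<exists>S. rfl_round F C d f p (cost_class \<epsilon> t) (fst S) (snd S)"
  proof
    fix t assume "t \<in> ?T"
    then obtain i where "i \<in> F" "f i \<in> cost_class \<epsilon> t" unfolding rfl_iterations_def by blast
    from ex_rfl_round[OF this] show "\<exists>S. rfl_round F C d f p (cost_class \<epsilon> t) (fst S) (snd S)"
      by auto
  qed
  then obtain S where
    S: "\<forall>t\<in>?T. rfl_round F C d f p (cost_class \<epsilon> t) (fst (S t)) (snd (S t))"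
    unfolding bchoice_iff by blast
  let ?c = "\<lambda>t. rfl_cost d f (fst (S t)) (snd (S t))"
  obtain t where "t \<in> ?T" "\<forall>s\<in>?T. ?c t \<le> ?c s"
    using arg_min_if_finite[OF finite_rfl_iterations[OF assms(1)] ne, of ?c] by (meson not_less)
  with S show ?thesis
    unfolding robust_fac_loc_def
    using \<open>t \<in> ?T\<close> \<open>\<forall>s\<in>?T. ?c t \<le> ?c s\<close>
    by (intro exI[of _ "fst (S t)"] exI[of _ "snd (S t)"] exI[of _ "\<lambda>t. fst (S t)"]
        exI[of _ "\<lambda>t. snd (S t)"] conjI bexI[of _ t]) (rule refl | assumption)+
qed

end

end

theory Submission
  imports Defs
begin

text \<open>Split the modified cost of an opened facility \<open>i\<close> among the clients, client \<open>j\<close> paying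
  \<open>max 0 (r i - d i j)\<close>. Balls of opened facilities are disjoint, so a covered client pays for
  its share and its connection at most \<open>2 r h + d h j\<close> for every processed \<open>h\<close>, and at most
  \<open>3 max (r h) (d h j)\<close> for every unprocessed \<open>h\<close>. The minimum over \<open>h\<close> of these bounds is the
  weight of \<open>j\<close>; summed over the \<open>p\<close> lightest clients it is at most \<open>3 OPT\<close>, as in the
  dual-fitting analysis of Mettu and Plaxton. Only the guessed facility and the facility \<open>k\<close>
  opened in the last greedy step are not paid for. Both cost at most \<open>(1 + \<epsilon>) f io\<close>, where \<open>io\<close> is
  the most expensive facility of the optimum and lies in the class of the current iteration.
  This alone gives \<open>5 + 2 \<epsilon>\<close>. The bound used here is \<open>4 + 2 \<epsilon>\<close>, at most \<open>5 + \<epsilon>\<close> for \<open>\<epsilon> \<le> 1\<close>.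
  If \<open>io\<close> was processed before \<open>k\<close>, the better weight \<open>2 r io + d io j\<close> saves \<open>f io\<close>. Otherwise
  \<open>r k \<le> r io\<close>, and exchanging the heaviest served clients for clients in the ball of \<open>k\<close> either
  saves as much or lets the clients pay for \<open>k\<close>.\<close>

subsection \<open>Sums over smallest subsets\<close>

text \<open>The common part cancels, and by cardinality \<open>A - B\<close> injects into
  \<open>B - A\<close> without sending any element to a lighter one. What the injection misses is
  nonnegative.\<close>

lemma sum_le_sum_exchange:
  fixes w :: "'a \<Rightarrow> real"
  assumes "finite A" "finite B" "card A \<le> card B"
    and le: "\<And>a b. a \<in> A - B \<Longrightarrow> b \<in> B - A \<Longrightarrow> w a \<le> w b"
    and nonneg: "\<And>b. b \<in> B \<Longrightarrow> 0 \<le> w b"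
  shows "sum w A \<le> sum w B"
proof -
  have "card (A - B) \<le> card (B - A)"
    using assms(1-3) card_Diff_subset_Int[of A B] card_Diff_subset_Int[of B A]
    by (simp add: Int_commute)
  then obtain e where e: "e ` (A - B) \<subseteq> B - A" "inj_on e (A - B)"
    using card_le_inj[of "A - B" "B - A"] assms by auto
  have "sum w (A - B) \<le> (\<Sum>a\<in>A - B. w (e a))"
    using e le by (intro sum_mono) blast
  also have "\<dots> = sum w (e ` (A - B))"
    by (simp add: sum.reindex[OF e(2)])
  also have "\<dots> \<le> sum w (B - A)"
    using e assms by (intro sum_mono2) auto
  finally show ?thesis
    using sum.Int_Diff[OF assms(1), of w B] sum.Int_Diff[OF assms(2), of w A]
    by (simp add: Int_commute)
qed

text \<open>\<open>X\<close> and \<open>Z\<close> are initial segments in the order by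
  \<open>w\<close>, so filling up \<open>X\<close> with the lightest elements of
  \<open>Z - X\<close> gives another one. In the main application they are the clients covered
  before and after the last greedy step.\<close>

lemma ex_smallest_between:
  fixes w :: "'a \<Rightarrow> real"
  assumes "finite C" "X \<subseteq> Z" "Z \<subseteq> C" "card X \<le> m" "m \<le> card Z"
    and X: "\<And>a b. a \<in> X \<Longrightarrow> b \<in> C - X \<Longrightarrow> w a \<le> w b"
    and Z: "\<And>a b. a \<in> Z \<Longrightarrow> b \<in> C - Z \<Longrightarrow> w a \<le> w b"
  obtains P where "X \<subseteq> P" "P \<subseteq> Z" "card P = m" "\<And>a b. a \<in> P \<Longrightarrow> b \<in> C - P \<Longrightarrow> w a \<le> w b"
proof -
  have fin: "finite X" "finite Z" using assms(1-3) by (auto intro: finite_subset)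
  then have "m - card X \<le> card (Z - X)" using assms(2,5) by (simp add: card_Diff_subset)
  then obtain B where B: "B \<subseteq> Z - X" "card B = m - card X" "\<forall>a\<in>B. \<forall>b\<in>Z - X - B. w a \<le> w b"
    using ex_smallest_subset[of "Z - X" "m - card X" w] fin by blast
  have "finite B" using B(1) fin finite_subset by blast
  then have "card (X \<union> B) = card X + card B"
    using B(1) fin by (intro card_Un_disjoint) auto
  then have "card (X \<union> B) = m" using B(2) assms(4) by simp
  moreover have "w a \<le> w b" if ab: "a \<in> X \<union> B" "b \<in> C - (X \<union> B)" for a b
  proof (cases "a \<in> X \<or> b \<notin> Z")
    case True
    then consider "a \<in> X" "b \<in> C - X" | "a \<in> Z" "b \<in> C - Z"
      using ab B(1) assms(2) by blast
    then show ?thesis by cases (simp_all add: X Z)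
  next
    case False
    then show ?thesis using B(3) ab by blast
  qed
  moreover have "X \<union> B \<subseteq> Z" using B(1) assms(2) by blast
  ultimately show ?thesis by (intro that[of "X \<union> B"]) auto
qed

text \<open>The outlier step compares distances only inside \<open>C'\<close> or only inside its
  complement, so optimality is claimed only against sets comparable with \<open>C'\<close>. Such a
  \<open>P\<close> has the size of \<open>S\<close>, which fixes the direction of the inclusion in
  each case.\<close>

lemma outlier_step_optimal:
  assumes "outlier_step d l H C' (C - C') S" "finite C" "C' \<subseteq> C" "l \<le> card C"
    and nonneg: "\<And>j. 0 \<le> dist_open d H j"
  shows "S \<subseteq> C" "card S = card C - l"
    and "\<And>P. P \<subseteq> C \<Longrightarrow> card P = card C - l \<Longrightarrow> P \<subseteq> C' \<or> C' \<subseteq> P \<Longrightarrow>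
      sum (dist_open d H) S \<le> sum (dist_open d H) P"
proof -
  have fin: "finite C'" using assms finite_subset by blast
  have card: "card (C - C') = card C - card C'" "card C' \<le> card C"
    using assms fin by (auto simp: card_Diff_subset card_mono)
  have "S \<subseteq> C \<and> card S = card C - l \<and> (\<forall>P. P \<subseteq> C \<longrightarrow> card P = card C - l \<longrightarrow>
      P \<subseteq> C' \<or> C' \<subseteq> P \<longrightarrow> (\<forall>a\<in>S - P. \<forall>b\<in>P - S. dist_open d H a \<le> dist_open d H b))"
  proof -
    consider "card (C - C') > l" | "card (C - C') < l" | "card (C - C') = l" by linarith
    then show ?thesis
    proof cases
      case 1
      then obtain O1 where O1: "O1 \<subseteq> C - C'" "card O1 = card (C - C') - l"
        "\<forall>a\<in>O1. \<forall>b\<in>C - C' - O1. dist_open d H a \<le> dist_open d H b" "S = C' \<union> O1"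
        using assms(1) unfolding outlier_step_def by auto
      have "card S = card C' + card O1"
        unfolding O1(4) using O1(1) fin assms(2) by (intro card_Un_disjoint) (auto intro: finite_subset)
      then have "card S = card C - l" using O1(2) 1 card by linarith
      moreover have "S \<subseteq> C" using O1(1,4) assms(3) by blast
      moreover have "dist_open d H a \<le> dist_open d H b"
        if "P \<subseteq> C" "card P = card C - l" "P \<subseteq> C' \<or> C' \<subseteq> P" "a \<in> S - P" "b \<in> P - S" for P a b
      proof -
        have "C' \<subseteq> P"
        proof (rule ccontr)
          assume "\<not> C' \<subseteq> P"
          then have "card P \<le> card C'" using that(3) card_mono[OF fin] by blast
          then show False using that(2) 1 card by linarith
        qed
        then show ?thesis using O1(3,4) that by blast
      qed
      ultimately show ?thesis by (intro conjI allI impI ballI)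
    next
      case 2
      then obtain O2 where O2: "O2 \<subseteq> C'" "card O2 = l - card (C - C')"
        "\<forall>a\<in>O2. \<forall>b\<in>C' - O2. dist_open d H b \<le> dist_open d H a" "S = C' - O2"
        using assms(1) unfolding outlier_step_def by auto
      have "card S = card C' - card O2"
        unfolding O2(4) using O2(1) fin by (intro card_Diff_subset) (auto intro: finite_subset)
      then have "card S = card C - l" using O2(2) 2 card assms(4) by linarith
      moreover have "S \<subseteq> C" using O2(4) assms(3) by blast
      moreover have "dist_open d H a \<le> dist_open d H b"
        if "P \<subseteq> C" "card P = card C - l" "P \<subseteq> C' \<or> C' \<subseteq> P" "a \<in> S - P" "b \<in> P - S" for P a b
      proof -
        have "P \<subseteq> C'"
        proof (rule ccontr)
          assume "\<not> P \<subseteq> C'"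
          moreover have "finite P" using that(1) assms(2) finite_subset by blast
          ultimately have "card C' \<le> card P" using that(3) card_mono by blast
          then show False using that(2) 2 card assms(4) by linarith
        qed
        then show ?thesis using O2(3,4) that by blast
      qed
      ultimately show ?thesis by (intro conjI allI impI ballI)
    next
      case 3
      then have S: "S = C'" using assms(1) unfolding outlier_step_def by auto
      have "P = C'" if "P \<subseteq> C" "card P = card C - l" "P \<subseteq> C' \<or> C' \<subseteq> P" for P
      proof -
        have "finite P" using that(1) assms(2) finite_subset by blast
        moreover have "card P = card C'" using that(2) 3 card assms(4) by linarith
        ultimately show ?thesis using that(3) fin card_subset_eq by metis
      qed
      then show ?thesis using S assms(3,4) 3 card by auto
    qed
  qed
  note S = conjunct1[OF this] conjunct1[OF conjunct2[OF this]]
    and le = conjunct2[OF conjunct2[OF this]]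
  show "S \<subseteq> C" "card S = card C - l" by (fact S)+
  fix P assume P: "P \<subseteq> C" "card P = card C - l" "P \<subseteq> C' \<or> C' \<subseteq> P"
  have "finite S" "finite P" using S P assms(2) finite_subset by blast+
  then show "sum (dist_open d H) S \<le> sum (dist_open d H) P"
    using S P le[rule_format, OF P] nonneg by (intro sum_le_sum_exchange) simp_all
qed

subsection \<open>Radii, shares and weights\<close>

text \<open>\<open>A\<close> stands for the facilities that an iteration keeps and \<open>g\<close>
  for their modified costs, which are real numbers there. The original opening costs enter in
  \<open>total_cost\<close>.\<close>

locale radii = Metric_space "F \<union> C" d
  for F C :: "'a set" and d :: "'a \<Rightarrow> 'a \<Rightarrow> real" +
  fixes A :: "'a set" and g r :: "'a \<Rightarrow> real"
  assumes finite_C: "finite C" and finite_A: "finite A" and A_subset: "A \<subseteq> F"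
    and r_nonneg: "\<And>i. i \<in> A \<Longrightarrow> 0 \<le> r i"
    and radius: "\<And>i. i \<in> A \<Longrightarrow> g i = (\<Sum>j\<in>C. max 0 (r i - d i j))"
begin

definition share :: "'a set \<Rightarrow> 'a \<Rightarrow> real" where
  "share H j = (\<Sum>i\<in>H. max 0 (r i - d i j))"

definition cov :: "'a set \<Rightarrow> real \<Rightarrow> 'a set" where
  "cov G \<rho> = {j \<in> C. \<exists>h\<in>G. d h j \<le> \<rho>}"

text \<open>\<open>G\<close> are the processed and \<open>H\<close> the opened facilities. \<open>\<rho>\<close> is the radius of the facility
  processed last, or \<open>0\<close> at the start.\<close>

definition greedy_inv :: "'a set \<Rightarrow> 'a set \<Rightarrow> real \<Rightarrow> bool" where
  "greedy_inv G H \<rho> \<longleftrightarrow> G \<subseteq> A \<and> H \<subseteq> G \<and> (\<forall>i\<in>G. r i \<le> \<rho>) \<and> (\<forall>i\<in>A - G. \<rho> \<le> r i) \<and>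
     (\<forall>i\<in>G. \<exists>h\<in>H. d h i \<le> 2 * r i \<and> r h \<le> r i) \<and>
     (\<forall>h\<in>H. \<forall>i\<in>H. h \<noteq> i \<longrightarrow> 2 * r h < d h i)"

text \<open>A processed \<open>h\<close> with \<open>r h < d h j\<close> also gets the coarser price
  \<open>3 * d h j\<close>. This keeps the price of a client outside the covered set at
  \<open>3 * \<rho>\<close> or more, as used in \<open>weight_outside\<close>;
  \<open>2 * r h + d h j\<close> could fall below that.\<close>

definition price :: "'a set \<Rightarrow> 'a \<Rightarrow> 'a \<Rightarrow> real" where
  "price G h j = (if h \<in> G \<and> d h j \<le> r h then 2 * r h + d h j else 3 * max (r h) (d h j))"

definition weight :: "'a set \<Rightarrow> 'a \<Rightarrow> real" where
  "weight G j = Min ((\<lambda>h. price G h j) ` A)"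

lemma cov_subset: "cov G \<rho> \<subseteq> C"
  by (auto simp: cov_def)

lemma cov_mono: "G \<subseteq> G' \<Longrightarrow> \<rho> \<le> \<rho>' \<Longrightarrow> cov G \<rho> \<subseteq> cov G' \<rho>'"
  by (force simp: cov_def)

section \<open>Invariant of the greedy phase\<close>

lemma greedy_invI:
  assumes "G \<subseteq> A" "H \<subseteq> G" "\<And>i. i \<in> G \<Longrightarrow> r i \<le> \<rho>" "\<And>i. i \<in> A - G \<Longrightarrow> \<rho> \<le> r i"
    and "\<And>i. i \<in> G \<Longrightarrow> \<exists>h\<in>H. d h i \<le> 2 * r i \<and> r h \<le> r i"
    and "\<And>h i. h \<in> H \<Longrightarrow> i \<in> H \<Longrightarrow> h \<noteq> i \<Longrightarrow> 2 * r h < d h i"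
  shows "greedy_inv G H \<rho>"
  unfolding greedy_inv_def by (intro conjI ballI impI assms)

lemma greedy_invD:
  assumes "greedy_inv G H \<rho>"
  shows "G \<subseteq> A" "H \<subseteq> G" "i \<in> G \<Longrightarrow> r i \<le> \<rho>" "i \<in> A - G \<Longrightarrow> \<rho> \<le> r i"
    and "i \<in> G \<Longrightarrow> \<exists>h\<in>H. d h i \<le> 2 * r i \<and> r h \<le> r i"
    and "h \<in> H \<Longrightarrow> i \<in> H \<Longrightarrow> h \<noteq> i \<Longrightarrow> 2 * r h < d h i"
  using assms by (simp_all add: greedy_inv_def)

text \<open>The sorting makes \<open>r k\<close> the largest radius processed so far. Hence an open
  facility that blocks \<open>k\<close> has radius at most \<open>r k\<close>, and if
  \<open>k\<close> is opened, its distance to every open facility exceeds twice either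
  radius.\<close>

lemma greedy_inv_step:
  assumes inv: "greedy_inv G H \<rho>" and k: "k \<in> A - G" and min: "\<And>i. i \<in> A - G \<Longrightarrow> r k \<le> r i"
  shows "greedy_inv (insert k G) (if \<exists>h\<in>H. d h k \<le> 2 * r k then H else insert k H) (r k)"
    (is "greedy_inv _ ?H _")
proof -
  note D = greedy_invD[OF inv]
  have le: "r i \<le> r k" if "i \<in> G" for i
    using D(3)[OF that] D(4)[OF k] by linarith
  have k0: "d k k = 0" "0 \<le> r k" using k A_subset r_nonneg by auto
  show ?thesis
  proof (rule greedy_invI)
    show "insert k G \<subseteq> A" "?H \<subseteq> insert k G" using D(1,2) k by auto
    show "r i \<le> r k" if "i \<in> insert k G" for i using that le by blast
    show "r k \<le> r i" if "i \<in> A - insert k G" for i using that min by blast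
    show "\<exists>h\<in>?H. d h i \<le> 2 * r i \<and> r h \<le> r i" if i: "i \<in> insert k G" for i
    proof (cases "i \<in> G")
      case True
      then obtain h where "h \<in> H" "d h i \<le> 2 * r i \<and> r h \<le> r i" using D(5) by blast
      then show ?thesis by (intro bexI[of _ h]) auto
    next
      case False
      then have "i = k" using i by blast
      show ?thesis
      proof (cases "\<exists>h\<in>H. d h k \<le> 2 * r k")
        case True
        then obtain h where "h \<in> H" "d h k \<le> 2 * r k" by blast
        then show ?thesis using \<open>i = k\<close> True le D(2) by (intro bexI[of _ h]) auto
      next
        case False
        then show ?thesis using \<open>i = k\<close> k0 by (intro bexI[of _ k]) auto
      qed
    qed
    show "2 * r h < d h i" if hi: "h \<in> ?H" "i \<in> ?H" "h \<noteq> i" for h i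
    proof (cases "h \<in> H \<and> i \<in> H")
      case True
      then show ?thesis using D(6) hi(3) by blast
    next
      case False
      have far: "2 * r k < d x k" "r x \<le> r k" if "x \<in> H" for x
        using False hi that le D(2) by (auto split: if_splits simp: not_le)
      consider "h = k" "i \<in> H" | "i = k" "h \<in> H"
        using False hi by (auto split: if_splits)
      then show ?thesis
      proof cases
        case 1
        then show ?thesis using far(1)[of i] commute[of i k] by simp
      next
        case 2
        then show ?thesis using far[of h] by simp
      qed
    qed
  qed
qed

text \<open>Radii do not decrease, so the accumulated clients are always
  \<open>cov G \<rho>\<close>. Either the list runs out with at least \<open>l\<close> outliers, or
  a last facility \<open>k\<close> brings their number to at most \<open>l\<close>. In the latter
  case the state before \<open>k\<close> is kept too, since the cost bounds compare both
  states.\<close>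

lemma greedy_run:
  assumes "greedy C d l r xs (cov G \<rho>) H (C - cov G \<rho>) G = (C', H', O')"
    and "greedy_inv G H \<rho>" "set xs = A - G" "distinct xs" "sorted (map r xs)"
    and "l \<le> card (C - cov G \<rho>)"
  shows "(\<exists>\<rho>'. greedy_inv A H' \<rho>' \<and> C' = cov A \<rho>' \<and> l \<le> card (C - C')) \<or>
    (\<exists>G H \<rho> k. greedy_inv G H \<rho> \<and> k \<in> A - G \<and> l \<le> card (C - cov G \<rho>) \<and>
       greedy_inv (insert k G) H' (r k) \<and> (H' = H \<or> H' = insert k H) \<and>
       C' = cov (insert k G) (r k) \<and> card (C - C') \<le> l)"
  using assms
proof (induction xs arbitrary: G H \<rho>)
  case Nil
  then have "G = A" using greedy_invD(1)[OF Nil.prems(2)] by auto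
  with Nil show ?case by auto
next
  case (Cons k xs)
  define H2 where "H2 = (if \<exists>h\<in>H. d h k \<le> 2 * r k then H else insert k H)"
  have k: "k \<in> A - G" using Cons.prems by auto
  have min: "r k \<le> r i" if "i \<in> A - G" for i
    using Cons.prems(5) that unfolding Cons.prems(3)[symmetric] by auto
  have inv: "greedy_inv (insert k G) H2 (r k)"
    unfolding H2_def using greedy_inv_step[OF Cons.prems(2) k min] .
  have "\<rho> \<le> r k" using greedy_invD(4)[OF Cons.prems(2) k] .
  then have "cov G \<rho> \<subseteq> cov (insert k G) (r k)" by (intro cov_mono) auto
  then have *: "cov G \<rho> \<union> {j \<in> C. \<exists>h\<in>insert k G. d h j \<le> r k} = cov (insert k G) (r k)"
    "C - cov G \<rho> - {j \<in> C. \<exists>h\<in>insert k G. d h j \<le> r k} = C - cov (insert k G) (r k)"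
    unfolding cov_def by blast+
  have eq: "(if card (C - cov (insert k G) (r k)) \<le> l
      then (cov (insert k G) (r k), H2, C - cov (insert k G) (r k))
      else greedy C d l r xs (cov (insert k G) (r k)) H2 (C - cov (insert k G) (r k)) (insert k G))
      = (C', H', O')"
    using Cons.prems(1) unfolding greedy.simps Let_def * H2_def by assumption
  show ?case
  proof (cases "card (C - cov (insert k G) (r k)) \<le> l")
    case True
    then have res: "C' = cov (insert k G) (r k)" "H' = H2" using eq by auto
    have "H2 = H \<or> H2 = insert k H" by (auto simp: H2_def)
    then show ?thesis using res inv True Cons.prems k by blast
  next
    case False
    have "set xs = A - insert k G" using Cons.prems(3,4) by auto
    then show ?thesis
      using Cons.IH[OF _ inv] eq False Cons.prems(4,5) by auto
  qed
qed

section \<open>Shares and connection costs for a fixed set of open facilities\<close>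

context
  fixes G H \<rho>
  assumes inv: "greedy_inv G H \<rho>"
begin

lemma finite_open: "finite H"
  by (rule finite_subset[OF subset_trans[OF greedy_invD(2,1)[OF inv]] finite_A])

lemma open_in:
  assumes "i \<in> H" shows "i \<in> A \<and> i \<in> G \<and> i \<in> F \<and> r i \<le> \<rho>"
proof -
  have "i \<in> G" using assms greedy_invD(2)[OF inv] by blast
  then show ?thesis using greedy_invD(1,3)[OF inv] A_subset by blast
qed

lemma open_far: "h \<in> H \<Longrightarrow> i \<in> H \<Longrightarrow> h \<noteq> i \<Longrightarrow> 2 * r h < d h i"
  by (rule greedy_invD(6)[OF inv])

lemma dist_open_le: "h \<in> H \<Longrightarrow> dist_open d H j \<le> d h j"
  unfolding dist_open_def using finite_open by (intro Min_le) auto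

lemma share_nonneg: "0 \<le> share H j"
  unfolding share_def by (intro sum_nonneg) auto

text \<open>Adding the two separation inequalities gives \<open>r h + r i < d h i\<close>, so a
  client strictly inside the ball of \<open>i\<close> is outside the ball of every other open
  \<open>h\<close> and pays only \<open>i\<close>.\<close>

lemma share_eq:
  assumes "i \<in> H" "j \<in> C" "d i j < r i"
  shows "share H j = r i - d i j"
proof -
  have "max 0 (r h - d h j) = 0" if "h \<in> H - {i}" for h
  proof -
    have "2 * r h < d h i" "2 * r i < d i h"
      using that assms open_far by auto
    moreover have "d h i \<le> d h j + d j i"
      using that assms open_in by (intro triangle) auto
    ultimately have "r h \<le> d h j"
      using assms(3) commute[of i h] commute[of i j] by linarith
    then show ?thesis by simp
  qed
  then have "(\<Sum>h\<in>H - {i}. max 0 (r h - d h j)) = 0" by (intro sum.neutral) blast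
  then show ?thesis
    unfolding share_def using assms finite_open by (subst sum.remove[of _ i]) auto
qed

lemma share_cases:
  assumes "j \<in> C"
  obtains "share H j = 0" "\<And>i. i \<in> H \<Longrightarrow> r i \<le> d i j"
  | i where "i \<in> H" "d i j < r i" "share H j = r i - d i j"
proof (cases "\<exists>i\<in>H. d i j < r i")
  case True
  then obtain i where i: "i \<in> H" "d i j < r i" by blast
  show ?thesis by (rule that(2)[OF i share_eq[OF i(1) assms i(2)]])
next
  case False
  then have le: "r i \<le> d i j" if "i \<in> H" for i using that by (simp add: not_less)
  then have "share H j = 0" unfolding share_def by (intro sum.neutral) auto
  then show ?thesis using le by (rule that(1))
qed

lemma share_le: "j \<in> C \<Longrightarrow> H \<noteq> {} \<Longrightarrow> share H j \<le> \<rho>"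
proof (erule share_cases)
  assume "H \<noteq> {}" and 0: "share H j = 0"
  then obtain i where "i \<in> H" by blast
  then show ?thesis using 0 open_in[of i] r_nonneg[of i] by linarith
next
  fix i assume "i \<in> H" "d i j < r i" "share H j = r i - d i j"
  then show ?thesis using open_in[of i] nonneg[of i j] by linarith
qed

lemma share_outside:
  assumes "j \<in> C - cov G \<rho>" shows "share H j = 0"
proof (rule share_cases[of j])
  show "j \<in> C" using assms by simp
next
  fix i assume "i \<in> H" "d i j < r i"
  then show ?thesis using assms open_in[of i] unfolding cov_def by force
qed

lemma sum_open_cost: "sum g H = sum (share H) C"
proof -
  have "sum g H = (\<Sum>i\<in>H. \<Sum>j\<in>C. max 0 (r i - d i j))"
    using open_in radius by (intro sum.cong) auto
  also have "\<dots> = sum (share H) C"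
    unfolding share_def by (rule sum.swap)
  finally show ?thesis .
qed

text \<open>Some open \<open>h\<close> lies within \<open>2 * r i\<close> of \<open>i\<close> and
  has \<open>r h \<le> r i\<close>. A client without a share reaches \<open>h\<close> through
  \<open>i\<close>. A client paying \<open>h'\<close> spends at most \<open>r h'\<close> altogether;
  if \<open>h'\<close> differs from \<open>h\<close>, separation gives \<open>r h' < d h j\<close>,
  and the route through \<open>i\<close> bounds this as before.\<close>

lemma share_dist_le:
  assumes "i \<in> G" "j \<in> C"
  shows "share H j + dist_open d H j \<le> 2 * r i + d i j"
proof -
  have i: "i \<in> F" "0 \<le> r i" 
    using assms(1) greedy_invD(1)[OF inv] A_subset r_nonneg[of i] by auto
  obtain h where h: "h \<in> H" "d h i \<le> 2 * r i" "r h \<le> r i"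
    using greedy_invD(5)[OF inv assms(1)] by blast
  have tri: "d h j \<le> d h i + d i j" using h assms i open_in by (intro triangle) auto
  show ?thesis
    using assms(2)
  proof (cases rule: share_cases)
    case 1
    then show ?thesis using dist_open_le[OF h(1), of j] tri h by linarith
  next
    case (2 h')
    have sum: "share H j + dist_open d H j \<le> r h'"
      using 2 dist_open_le[of h' j] by linarith
    show ?thesis
    proof (cases "h' = h")
      case True
      then show ?thesis using sum[unfolded True] h i nonneg[of i j] by linarith
    next
      case False
      then have "2 * r h' < d h' h" using open_far 2 h by blast
      moreover have "d h' h \<le> d h' j + d j h" using h assms 2 open_in by (intro triangle) auto
      ultimately show ?thesis using sum tri h 2 commute[of j h] by linarith
    qed
  qed
qed

lemma share_dist_le_cov:
  assumes "j \<in> cov G \<rho>"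
  shows "share H j + dist_open d H j \<le> 3 * \<rho>"
proof -
  obtain h where "h \<in> G" "d h j \<le> \<rho>" "j \<in> C" using assms unfolding cov_def by blast
  then show ?thesis using share_dist_le[of h j] greedy_invD(3)[OF inv, of h] by linarith
qed

end

section \<open>Weights of clients\<close>

context
  fixes G :: "'a set"
  assumes A_nonempty: "A \<noteq> {}"
begin

lemma weight_attained: obtains h where "h \<in> A" "weight G j = price G h j"
proof -
  have "weight G j \<in> (\<lambda>h. price G h j) ` A"
    unfolding weight_def using finite_A A_nonempty by (intro Min_in) auto
  then show ?thesis using that by blast
qed

lemma weight_le: "h \<in> A \<Longrightarrow> weight G j \<le> price G h j"
  unfolding weight_def using finite_A by (intro Min_le) auto

text \<open>The maximum is the payment of \<open>j\<close> to \<open>h\<close> in the radius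
  equation, so that summing over clients turns it into \<open>g h\<close>.\<close>

lemma weight_le3:
  assumes "h \<in> A" shows "weight G j \<le> 3 * d h j + 3 * max 0 (r h - d h j)"
  using weight_le[OF assms, of j] unfolding price_def by (auto simp: max_def split: if_splits)

text \<open>For a client in the ball, \<open>2 * r h + d h j\<close> equals
  \<open>3 * d h j + 2 * (r h - d h j)\<close>. A processed facility is thus charged twice instead
  of three times.\<close>

lemma weight_le2:
  assumes "h \<in> A" "h \<in> G" shows "weight G j \<le> 3 * d h j + 2 * max 0 (r h - d h j)"
  using weight_le[OF assms(1), of j] assms(2) unfolding price_def
  by (auto simp: max_def split: if_splits)

lemma weight_nonneg: "0 \<le> weight G j"
proof -
  obtain h where "h \<in> A" "weight G j = price G h j" by (rule weight_attained)
  then show ?thesis using nonneg[of h j] r_nonneg[of h] unfolding price_def by auto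
qed

text \<open>With \<open>weight_outside\<close> this makes \<open>3 * \<rho>'\<close> a threshold
  between covered and uncovered clients. Covered sets are therefore initial segments in the order by
  weight, as \<open>ex_smallest_between\<close> requires.\<close>

lemma weight_cov:
  assumes "greedy_inv G' H' \<rho>'" "j \<in> cov G' \<rho>'"
  shows "weight G j \<le> 3 * \<rho>'"
proof -
  obtain h where h: "h \<in> G'" "d h j \<le> \<rho>'" using assms unfolding cov_def by auto
  then have "h \<in> A" "r h \<le> \<rho>'" using greedy_invD(1,3)[OF assms(1)] by auto
  then show ?thesis using weight_le3[of h j] h by (auto simp: max_def split: if_splits)
qed

lemma weight_outside:
  assumes "greedy_inv G' H' \<rho>'" "G \<subseteq> G'" "j \<in> C - cov G' \<rho>'"
  shows "3 * \<rho>' \<le> weight G j"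
proof -
  obtain h where h: "h \<in> A" "weight G j = price G h j" by (rule weight_attained)
  show ?thesis
  proof (cases "h \<in> G'")
    case True
    then have "\<rho>' < d h j" "r h \<le> \<rho>'" 
      using assms(3) greedy_invD(3)[OF assms(1)] unfolding cov_def by (auto simp: not_le)
    then show ?thesis using h unfolding price_def by auto
  next
    case False
    then have "\<rho>' \<le> r h" "h \<notin> G" using assms(2) h greedy_invD(4)[OF assms(1)] by auto
    then show ?thesis using h unfolding price_def by auto
  qed
qed

text \<open>Let \<open>h\<close> attain the weight. If it is processed, \<open>share_dist_le\<close>
  applies, and both forms of the price dominate that bound. If not, \<open>j\<close> is covered and
  \<open>3 * \<rho>' \<le> 3 * r h\<close>.\<close>

lemma share_dist_le_weight:
  assumes "greedy_inv G' H' \<rho>'" "G \<subseteq> G'" "j \<in> C" "j \<in> cov G' \<rho>' \<or> G' = A"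
  shows "share H' j + dist_open d H' j \<le> weight G j"
proof -
  obtain h where h: "h \<in> A" "weight G j = price G h j" by (rule weight_attained)
  show ?thesis
  proof (cases "h \<in> G'")
    case True
    then show ?thesis using share_dist_le[OF assms(1) True assms(3)] h unfolding price_def
      by (auto simp: max_def)
  next
    case False
    then have "\<rho>' \<le> r h" "j \<in> cov G' \<rho>'" "h \<notin> G"
      using assms(2,4) h greedy_invD(4)[OF assms(1)] by auto
    then show ?thesis
      using share_dist_le_cov[OF assms(1), of j] h unfolding price_def by auto
  qed
qed

end

subsection \<open>Cost of one iteration\<close>

text \<open>Each client is charged to its facility \<open>\<sigma> j\<close>. Grouped by facility,
  the payments to \<open>i\<close> are part of its radius equation and total at most
  \<open>g i\<close>; the multiplier \<open>m i\<close> will be 2 or 3.\<close>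

lemma weight_sum_le:
  assumes "U \<subseteq> C" "K \<subseteq> A" and \<sigma>: "\<And>j. j \<in> U \<Longrightarrow> \<sigma> j \<in> K"
    and w: "\<And>i j. i \<in> K \<Longrightarrow> w j \<le> 3 * d i j + m i * max 0 (r i - d i j)"
    and m: "\<And>i. i \<in> K \<Longrightarrow> 0 \<le> m i"
  shows "sum w U \<le> 3 * (\<Sum>j\<in>U. d (\<sigma> j) j) + (\<Sum>i\<in>K. m i * g i)"
proof -
  have fin: "finite U" "finite K" using assms finite_C finite_A finite_subset by blast+
  let ?h = "\<lambda>j. m (\<sigma> j) * max 0 (r (\<sigma> j) - d (\<sigma> j) j)"
  have "sum ?h U = (\<Sum>i\<in>K. sum ?h {j \<in> U. \<sigma> j = i})"
    using fin \<sigma> by (intro sum.group[symmetric]) auto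
  also have "\<dots> \<le> (\<Sum>i\<in>K. m i * g i)"
  proof (rule sum_mono)
    fix i assume i: "i \<in> K"
    have "sum ?h {j \<in> U. \<sigma> j = i} = (\<Sum>j\<in>{j \<in> U. \<sigma> j = i}. m i * max 0 (r i - d i j))"
      by (intro sum.cong) auto
    also have "\<dots> \<le> (\<Sum>j\<in>C. m i * max 0 (r i - d i j))"
      using assms(1) finite_C m[OF i] by (intro sum_mono2) auto
    also have "\<dots> = m i * g i"
      using i assms(2) by (simp add: radius sum_distrib_left subset_iff)
    finally show "sum ?h {j \<in> U. \<sigma> j = i} \<le> m i * g i" .
  qed
  finally have "sum ?h U \<le> (\<Sum>i\<in>K. m i * g i)" .
  moreover have "sum w U \<le> (\<Sum>j\<in>U. 3 * d (\<sigma> j) j + ?h j)"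
    using w \<sigma> by (intro sum_mono) blast
  ultimately show ?thesis by (simp add: sum.distrib sum_distrib_left)
qed

section \<open>Paying for the facilities opened before the last step\<close>

context
  fixes G H \<rho> G' H' \<rho>' P
  assumes inv: "greedy_inv G H \<rho>" and inv': "greedy_inv G' H' \<rho>'"
    and sub: "H \<subseteq> H'" "G \<subseteq> G'" and A_nonempty: "A \<noteq> {}"
    and P: "cov G \<rho> \<subseteq> P" "P \<subseteq> C" "P \<subseteq> cov G' \<rho>' \<or> G' = A"
begin

lemma share_mono: "share H j \<le> share H' j"
  unfolding share_def using sub finite_open[OF inv'] by (intro sum_mono2) auto

lemma share_dist_sum_le:
  assumes "U \<subseteq> P"
  shows "sum (share H') U + sum (dist_open d H') U \<le> sum (weight G) U"
  unfolding sum.distrib[symmetric]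
proof (rule sum_mono)
  fix j assume "j \<in> U"
  then show "share H' j + dist_open d H' j \<le> weight G j"
    using assms P share_dist_le_weight[OF A_nonempty inv' sub(2), of j] by blast
qed

lemma sum_share_on: "sum (share H) C = sum (share H) P"
  using P finite_C share_outside[OF inv] by (intro sum.mono_neutral_right) auto

text \<open>Shares in \<open>H\<close> vanish outside \<open>cov G \<rho>\<close>, so the clients of
  \<open>P\<close> pay for \<open>H\<close> completely. A facility in \<open>H' - H\<close> may have
  its payers outside \<open>P\<close>, which is why only \<open>g\<close> over \<open>H\<close>
  appears.\<close>

lemma service_cost: "sum g H + sum (dist_open d H') P \<le> sum (weight G) P"
proof -
  have "sum (share H) P \<le> sum (share H') P"
    using share_mono by (intro sum_mono)
  then show ?thesis
    using share_dist_sum_le[of P] sum_share_on sum_open_cost[OF inv] by simp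
qed

end

text \<open>The clients of \<open>P - P'\<close> are replaced, as far as possible, by clients in the ball of \<open>k\<close>. The
  first bound omits the cost of \<open>k\<close>; it arises when the ball has enough clients outside \<open>P'\<close>.
  Otherwise every client of the ball is served, and together they pay for \<open>k\<close>.\<close>

lemma exchange_cost:
  assumes inv: "greedy_inv G H \<rho>" and inv': "greedy_inv (insert k G) (insert k H) (r k)"
    and k: "k \<in> A - G" and P: "cov G \<rho> \<subseteq> P" "P \<subseteq> cov (insert k G) (r k)" and P': "P' \<subseteq> P"
  obtains S where "S \<subseteq> cov (insert k G) (r k)" "card S = card P"
    "sum g H + sum (dist_open d (insert k H)) S \<le> sum (weight G) P' + 2 * (real (card (P - P')) * r k)
      \<or> sum g (insert k H) + sum (dist_open d (insert k H)) S
        \<le> sum (weight G) P' + 3 * (real (card (P - P')) * r k)"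
proof -
  define H' D B Q where "H' = insert k H" "D = dist_open d H'" "B = {j \<in> C. d k j < r k}" "Q = P - P'"
  note defs = this
  have PC: "P \<subseteq> C" using P cov_subset by blast
  then have fin: "finite P" "finite P'" "finite Q" "finite B" "finite H'"
    using P' finite_C finite_open[OF inv'] by (auto simp: defs intro: finite_subset)
  have rk: "0 \<le> r k" using k r_nonneg by auto
  have A: "A \<noteq> {}" using k by auto
  have BZ: "B \<subseteq> cov (insert k G) (r k)" unfolding defs cov_def by auto
  have cardP: "card P = card P' + card Q"
    using P' fin by (simp add: defs card_Diff_subset card_mono)
  have mono: "share H j \<le> share H' j" for j
    unfolding share_def using fin by (intro sum_mono2) (auto simp: defs)
  have inv'': "greedy_inv (insert k G) H' (r k)" using inv' by (simp add: defs)
  note facts = inv inv'' subset_insertI[of H k, folded defs(1)] subset_insertI[of G k] A P(1) PC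
    disjI1[OF P(2)]
  have P'_le: "sum (share H') P' + sum D P' \<le> sum (weight G) P'"
    unfolding defs(2) by (rule share_dist_sum_le[OF facts P'])
  have share_rk: "share H' j \<le> r k" if "j \<in> C" for j
    using share_le[OF inv'' that] by (simp add: defs)
  show ?thesis
  proof (cases "card Q \<le> card (B - P')")
    case True
    \<comment> \<open>The clients \<open>N\<close> replace \<open>Q\<close>. Each connects to
      \<open>k\<close> within \<open>r k\<close>, and each dropped client leaves a share of at most
      \<open>r k\<close> unpaid, whence the factor 2.\<close>
    then obtain N where N: "N \<subseteq> B - P'" "card N = card Q"
      using obtain_subset_with_card_n by metis
    have finN: "finite N" using N(1) fin finite_subset by blast
    have disj: "P' \<inter> N = {}" using N by blast
    have "sum D N \<le> real (card N) * r k"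
    proof (rule sum_bounded_above)
      fix j assume "j \<in> N"
      then have "d k j < r k" using N(1) by (auto simp: defs)
      then show "D j \<le> r k"
        using dist_open_le[OF inv'', of k j] by (auto simp: defs)
    qed
    moreover have "sum (share H) Q \<le> real (card Q) * r k"
    proof (rule sum_bounded_above)
      fix j assume "j \<in> Q"
      then show "share H j \<le> r k" using mono[of j] share_rk[of j] PC by (auto simp: defs)
    qed
    moreover have "sum (share H) P' \<le> sum (share H') P'" using mono by (intro sum_mono)
    moreover have "sum g H = sum (share H) P' + sum (share H) Q"
    proof -
      have "sum g H = sum (share H) P" using sum_open_cost[OF inv] sum_share_on[OF facts] by simp
      then show ?thesis using P' fin by (simp add: defs sum.subset_diff[of P' P])
    qed
    moreover have "sum D (P' \<union> N) = sum D P' + sum D N"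
      using fin finN disj by (intro sum.union_disjoint)
    ultimately have "sum g H + sum D (P' \<union> N) \<le> sum (weight G) P' + 2 * (real (card Q) * r k)"
      using P'_le N(2) by simp
    moreover have "card (P' \<union> N) = card P"
      using card_Un_disjoint[OF fin(2) finN disj] N cardP by simp
    moreover have "P' \<union> N \<subseteq> cov (insert k G) (r k)" using P P' N BZ by blast
    ultimately show ?thesis using that[of "P' \<union> N"] by (simp add: defs)
  next
    case False
    \<comment> \<open>The whole ball is served now, and \<open>R\<close> fills up the number of
      clients. The set \<open>L\<close> of dropped clients outside the ball has at most
      \<open>m\<close> elements. Charging \<open>3 * r k\<close> per client of \<open>R\<close>,
      \<open>r k\<close> per new ball client and \<open>r k\<close> per client of \<open>L\<close>
      stays within \<open>3 * r k\<close> per client of \<open>Q\<close>.\<close>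
    define m where "m = card (B - P')"
    have "card (Q \<inter> B) \<le> m"
      unfolding m_def using fin by (intro card_mono) (auto simp: defs)
    moreover have "card Q = card (Q - B) + card (Q \<inter> B)"
      using fin by (metis Int_commute card_Diff_subset_Int card_mono finite_Int inf_le1 le_add_diff_inverse2)
    ultimately have "card Q - m \<le> card (Q - B)" by simp
    then obtain R where R: "R \<subseteq> Q - B" "card R = card Q - m"
      using obtain_subset_with_card_n by metis
    have finR: "finite R" using R(1) fin finite_subset by blast
    define L where "L = Q - B - R"
    have "card L = card (Q - B) - card R"
      unfolding L_def using R(1) finR by (simp add: card_Diff_subset)
    then have cardL: "card L \<le> m"
      using R(2) card_mono[of Q "Q - B"] fin by auto
    have union: "sum w (P' \<union> (B - P') \<union> R) = sum w P' + sum w (B - P') + sum w R" for w :: "'a \<Rightarrow> real"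
    proof -
      have "(P' \<union> (B - P')) \<inter> R = {}" using R(1) by (auto simp: defs)
      then have "sum w (P' \<union> (B - P') \<union> R) = sum w (P' \<union> (B - P')) + sum w R"
        using fin finR by (intro sum.union_disjoint) auto
      also have "sum w (P' \<union> (B - P')) = sum w P' + sum w (B - P')"
        using fin by (intro sum.union_disjoint) auto
      finally show ?thesis .
    qed
    have "sum g H' = sum (share H') C" by (rule sum_open_cost[OF inv''])
    \<comment> \<open>The union is \<open>P \<union> B\<close>. Outside it nobody pays: shares in
      \<open>H\<close> live on \<open>cov G \<rho>\<close>, and those of \<open>k\<close> live on
      its ball.\<close>
    also have "\<dots> = sum (share H') (P' \<union> (B - P') \<union> R \<union> L)"
    proof (rule sum.mono_neutral_right[OF finite_C])
      show "P' \<union> (B - P') \<union> R \<union> L \<subseteq> C" using PC P' R by (auto simp: defs L_def)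
      show "\<forall>j\<in>C - (P' \<union> (B - P') \<union> R \<union> L). share H' j = 0"
      proof
        fix j assume "j \<in> C - (P' \<union> (B - P') \<union> R \<union> L)"
        then have j: "j \<in> C" "j \<notin> P" "r k \<le> d k j" by (auto simp: defs L_def)
        then have "share H j = 0" using share_outside[OF inv, of j] P(1) by blast
        moreover have "share H' j = share H j"
          unfolding share_def defs(1) using j(3) finite_open[OF inv] by (cases "k \<in> H") (auto simp: insert_absorb)
        ultimately show "share H' j = 0" by simp
      qed
    qed
    also have "\<dots> = sum (share H') (P' \<union> (B - P') \<union> R) + sum (share H') L"
      using fin finR R(1) by (intro sum.union_disjoint) (auto simp: defs L_def)
    finally have g: "sum g H' = sum (share H') P' + sum (share H') (B - P') + sum (share H') R
        + sum (share H') L" by (simp only: union)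
    have "sum (share H') L \<le> real (card L) * r k"
    proof (rule sum_bounded_above)
      fix j assume "j \<in> L"
      then show "share H' j \<le> r k" using share_rk[of j] PC by (auto simp: defs L_def)
    qed
    also have "\<dots> \<le> real m * r k" using cardL rk by (intro mult_right_mono) auto
    finally have L: "sum (share H') L \<le> real m * r k" .
    have B: "sum (share H') (B - P') + sum D (B - P') \<le> real m * r k"
      unfolding sum.distrib[symmetric] m_def
    proof (rule sum_bounded_above)
      fix j assume "j \<in> B - P'"
      then have j: "j \<in> C" "d k j < r k" by (auto simp: defs)
      then show "share H' j + D j \<le> r k"
        using share_eq[OF inv'', of k j] dist_open_le[OF inv'', of k j] by (auto simp: defs)
    qed
    have Rle: "sum (share H') R + sum D R \<le> real (card R) * (3 * r k)"
      unfolding sum.distrib[symmetric]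
    proof (rule sum_bounded_above)
      fix j assume "j \<in> R"
      then have "j \<in> cov (insert k G) (r k)" using R(1) P(2) by (auto simp: defs)
      then show "share H' j + D j \<le> 3 * r k"
        unfolding defs(2) by (rule share_dist_le_cov[OF inv''])
    qed
    have "real (card R) = real (card Q) - real m" using R(2) False by (simp add: m_def of_nat_diff)
    then have cR: "real (card R) * (3 * r k) = 3 * (real (card Q) * r k) - 3 * (real m * r k)"
      by (simp add: left_diff_distrib)
    have "0 \<le> real m * r k" using rk by simp
    then have "sum g H' + sum D (P' \<union> (B - P') \<union> R) \<le> sum (weight G) P' + 3 * (real (card Q) * r k)"
      using g P'_le L B Rle cR unfolding union by linarith
    moreover have "card (P' \<union> (B - P') \<union> R) = card P"
    proof -
      have "card (P' \<union> (B - P') \<union> R) = card (P' \<union> (B - P')) + card R"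
        using fin finR R(1) by (intro card_Un_disjoint) (auto simp: defs)
      also have "card (P' \<union> (B - P')) = card P' + m"
        unfolding m_def using fin by (intro card_Un_disjoint) auto
      finally show ?thesis using R(2) cardP False by (simp add: m_def)
    qed
    moreover have "P' \<union> (B - P') \<union> R \<subseteq> cov (insert k G) (r k)"
      using P P' R BZ by (auto simp: defs)
    ultimately show ?thesis using that[of "P' \<union> (B - P') \<union> R"] by (simp add: defs)
  qed
qed

text \<open>The map \<open>\<sigma>\<close> assigns the clients of the comparison solution to its
  facilities. Every branch reduces to \<open>cheap\<close>, where only \<open>ie\<close> is left
  unpaid, or to \<open>finish\<close>, where both \<open>ie\<close> and \<open>k\<close> may be
  unpaid but one \<open>f io\<close> has been saved.\<close>

lemma total_cost:
  fixes f :: "'a \<Rightarrow> real" and \<sigma> :: "'a \<Rightarrow> 'a"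
  assumes g: "\<And>i. i \<in> A \<Longrightarrow> g i = (if i = ie then 0 else f i)"
    and f: "\<And>i. i \<in> A \<Longrightarrow> 0 \<le> f i" "\<And>i. i \<in> A \<Longrightarrow> f i \<le> f ie"
    and Fo: "Fo \<subseteq> A" "io \<in> Fo" and \<epsilon>: "0 \<le> \<epsilon>" "f ie \<le> (1 + \<epsilon>) * f io" and ie: "ie \<in> A"
    and Co: "Co \<subseteq> C" "p \<le> card Co" "\<And>j. j \<in> Co \<Longrightarrow> \<sigma> j \<in> Fo"
    and run: "(\<exists>\<rho>'. greedy_inv A H' \<rho>' \<and> C' = cov A \<rho>' \<and> card C' \<le> p) \<or>
      (\<exists>G H \<rho> k. greedy_inv G H \<rho> \<and> k \<in> A - G \<and> card (cov G \<rho>) \<le> p \<and>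
        greedy_inv (insert k G) H' (r k) \<and> (H' = H \<or> H' = insert k H) \<and>
        C' = cov (insert k G) (r k) \<and> p \<le> card C')"
    and S: "\<And>P. P \<subseteq> C \<Longrightarrow> card P = p \<Longrightarrow> P \<subseteq> C' \<or> C' \<subseteq> P \<Longrightarrow>
      sum (dist_open d H') S \<le> sum (dist_open d H') P"
  shows "sum f H' + sum (dist_open d H') S
    \<le> (4 + 2 * \<epsilon>) * (sum f Fo + (\<Sum>j\<in>Co. d (\<sigma> j) j))"
proof -
  let ?D = "dist_open d H'"
  define Z where "Z = sum f Fo + (\<Sum>j\<in>Co. d (\<sigma> j) j)"
  have A: "A \<noteq> {}" using ie by blast
  have fin: "finite Fo" "finite Co" "finite H'"
    using Fo(1) Co(1) finite_A finite_C finite_open run by (auto intro: finite_subset)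
  have HA: "H' \<subseteq> A" using run greedy_invD(1,2) by blast
  have fFo: "0 \<le> f i" if "i \<in> Fo" for i using that Fo(1) f(1) by blast
  have dist0: "0 \<le> (\<Sum>j\<in>U. d (\<sigma> j) j)" for U by (intro sum_nonneg) simp
  have fio: "f io \<le> sum f Fo" "0 \<le> f io"
    using member_le_sum[of io Fo f] Fo(2) fin fFo by auto
  have Z0: "f io \<le> Z" unfolding Z_def using fio dist0[of Co] by linarith
  have \<epsilon>io: "0 \<le> \<epsilon> * f io" "\<epsilon> * f io \<le> \<epsilon> * Z" using \<epsilon>(1) fio Z0 by (auto intro: mult_left_mono)
  have fie: "f ie \<le> f io + \<epsilon> * f io" using \<epsilon>(2) by (simp add: algebra_simps)
  have sumf: "sum f H' \<le> f ie + sum g H'"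
  proof (cases "ie \<in> H'")
    case True
    then have "sum f H' = f ie + sum f (H' - {ie})" "sum g H' = g ie + sum g (H' - {ie})"
      using fin by (auto intro: sum.remove)
    moreover have "sum f (H' - {ie}) = sum g (H' - {ie})" using HA g by (intro sum.cong) auto
    ultimately show ?thesis using g[OF ie] by simp
  next
    case False
    then have "sum f H' = sum g H'" using HA g by (intro sum.cong) auto
    then show ?thesis using f(1)[OF ie] by simp
  qed
  have gFo: "sum g Fo \<le> sum f Fo" using g f(1) f(1)[OF ie] Fo(1) by (intro sum_mono) (simp add: subset_iff)
  have w3: "sum (weight G) Co \<le> 3 * (\<Sum>j\<in>Co. d (\<sigma> j) j) + 3 * sum g Fo" for G
  proof -
    have "sum (weight G) Co \<le> 3 * (\<Sum>j\<in>Co. d (\<sigma> j) j) + (\<Sum>i\<in>Fo. 3 * g i)"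
      using Co Fo(1) weight_le3[OF A] by (intro weight_sum_le) auto
    then show ?thesis by (simp add: sum_distrib_left)
  qed
  have smallest: "sum (weight G) P \<le> sum (weight G) Co"
    if "P \<subseteq> C" "card P = p" "\<And>a b. a \<in> P \<Longrightarrow> b \<in> C - P \<Longrightarrow> weight G a \<le> weight G b" for G P
  proof (rule sum_le_sum_exchange)
    show "finite P" using that(1) finite_C finite_subset by blast
    show "weight G a \<le> weight G b" if "a \<in> P - Co" "b \<in> Co - P" for a b
      using that \<open>\<And>a b. a \<in> P \<Longrightarrow> b \<in> C - P \<Longrightarrow> weight G a \<le> weight G b\<close>[of a b] Co(1) by blast
  qed (use fin Co that weight_nonneg[OF A] in auto)
  have cheap: ?thesis if "sum g H' + sum ?D S \<le> sum (weight G) Co" for G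
  proof -
    have "sum f H' + sum ?D S \<le> f ie + 3 * Z"
      using that sumf w3[of G] gFo unfolding Z_def by (simp add: algebra_simps)
    then show ?thesis using fie \<epsilon>io Z0 unfolding Z_def[symmetric] by (simp add: algebra_simps)
  qed
  \<comment> \<open>Here \<open>2 * f ie - f io\<close> is at most
    \<open>f io + 2 * \<epsilon> * f io\<close>, and \<open>f io \<le> Z\<close> turns
    \<open>3 * Z\<close> into \<open>4 * Z\<close>.\<close>
  have finish: ?thesis if "sum f H' + sum ?D S \<le> 2 * f ie + 3 * Z - f io"
  proof -
    have "sum f H' + sum ?D S \<le> 4 * Z + 2 * (\<epsilon> * Z)" using that fie \<epsilon>io Z0 by linarith
    then show ?thesis unfolding Z_def[symmetric] by (simp add: algebra_simps)
  qed
  show ?thesis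
    using run
  proof
    assume "\<exists>\<rho>'. greedy_inv A H' \<rho>' \<and> C' = cov A \<rho>' \<and> card C' \<le> p"
    then obtain \<rho>' where inv: "greedy_inv A H' \<rho>'" and C': "C' = cov A \<rho>'" "card C' \<le> p"
      by blast
    have pC: "p \<le> card C" using Co(2) card_mono[OF finite_C Co(1)] by linarith
    have C'C: "C' \<subseteq> C" using C'(1) cov_subset by simp
    have C'_min: "weight A a \<le> weight A b" if "a \<in> C'" "b \<in> C - C'" for a b
      using weight_cov[OF A inv, of a A] weight_outside[OF A inv subset_refl, of b] that
      unfolding C'(1) by linarith
    obtain P where P: "C' \<subseteq> P" "P \<subseteq> C" "card P = p"
      "\<And>a b. a \<in> P \<Longrightarrow> b \<in> C - P \<Longrightarrow> weight A a \<le> weight A b"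
      by (rule ex_smallest_between[OF finite_C C'C subset_refl C'(2) pC C'_min]) auto
    \<comment> \<open>There is no last facility in this case, so the same state serves as the one
      before and the one after.\<close>
    have "sum g H' + sum ?D P \<le> sum (weight A) P"
      using P(1) C'(1) by (intro service_cost[OF inv inv _ _ A _ P(2)]) auto
    also have "\<dots> \<le> sum (weight A) Co" by (rule smallest[OF P(2-4)])
    finally show ?thesis using S[OF P(2,3)] P(1) by (intro cheap[of A]) auto
  next
    assume "\<exists>G H \<rho> k. greedy_inv G H \<rho> \<and> k \<in> A - G \<and> card (cov G \<rho>) \<le> p \<and>
      greedy_inv (insert k G) H' (r k) \<and> (H' = H \<or> H' = insert k H) \<and>
      C' = cov (insert k G) (r k) \<and> p \<le> card C'"
    then obtain G H \<rho> k where inv: "greedy_inv G H \<rho>" and k: "k \<in> A - G" and small: "card (cov G \<rho>) \<le> p"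
      and inv': "greedy_inv (insert k G) H' (r k)" and H': "H' = H \<or> H' = insert k H"
      and C': "C' = cov (insert k G) (r k)" "p \<le> card C'"
      by blast
    have C'C: "C' \<subseteq> C" using C'(1) cov_subset by simp
    have cC': "cov G \<rho> \<subseteq> C'"
      using greedy_invD(4)[OF inv k] unfolding C'(1) by (intro cov_mono) auto
    have cov_min: "weight G a \<le> weight G b" if "a \<in> cov G \<rho>" "b \<in> C - cov G \<rho>" for a b
      using weight_cov[OF A inv that(1), of G] weight_outside[OF A inv subset_refl that(2)]
      by linarith
    have C'_min: "weight G a \<le> weight G b" if "a \<in> C'" "b \<in> C - C'" for a b
      using weight_cov[OF A inv', of a G] weight_outside[OF A inv' subset_insertI, of b] that
      unfolding C'(1) by linarith
    obtain P where P: "cov G \<rho> \<subseteq> P" "P \<subseteq> C'" "card P = p"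
      and P_min: "\<And>a b. a \<in> P \<Longrightarrow> b \<in> C - P \<Longrightarrow> weight G a \<le> weight G b"
      by (rule ex_smallest_between[OF finite_C cC' C'C small C'(2) cov_min C'_min]) auto
    have PC: "P \<subseteq> C" using P(2) C'C by blast
    then have finP: "finite P" using finite_C finite_subset by blast
    have "H \<subseteq> H'" using H' by blast
    then have service: "sum g H + sum ?D P \<le> sum (weight G) P"
      using P(2) C'(1) by (intro service_cost[OF inv inv' _ _ A P(1) PC]) auto
    have SP: "sum ?D S \<le> sum ?D P" using S[OF PC P(3)] P(2) by blast
    have P_Co: "sum (weight G) P \<le> sum (weight G) Co" by (rule smallest[OF PC P(3) P_min])
    have "k \<notin> H" using k greedy_invD(2)[OF inv] by blast
    show ?thesis
      using H'
    proof
      assume "H' = H"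
      then show ?thesis using service SP P_Co by (intro cheap[of G]) simp
    next
      assume H'k: "H' = insert k H"
      then have gH': "sum g H' = g k + sum g H" using \<open>k \<notin> H\<close> fin by simp
      have gk: "g k \<le> f ie" using g[of k] f(2)[of k] f(1)[OF ie] k by auto
      show ?thesis
      proof (cases "ie \<in> Fo")
        case True
        \<comment> \<open>The comparison solution pays \<open>f ie\<close> while its modified cost
          is 0. The threefold saving more than covers the required \<open>f io\<close>.\<close>
        have "sum g Fo \<le> sum f Fo - f ie"
        proof -
          have "sum f Fo = f ie + sum f (Fo - {ie})" "sum g Fo = g ie + sum g (Fo - {ie})"
            using fin True by (auto intro: sum.remove)
          moreover have "sum g (Fo - {ie}) = sum f (Fo - {ie})" using Fo g by (intro sum.cong) auto
          ultimately show ?thesis using g[OF ie] by simp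
        qed
        moreover have "f io \<le> f ie" using f(2) Fo by blast
        ultimately show ?thesis
          using service SP P_Co w3[of G] gH' gk sumf f(1)[OF ie]
          unfolding Z_def by (intro finish) (simp add: Z_def)
      next
        case False
        then have gf: "g i = f i" if "i \<in> Fo" for i using that g[of i] Fo(1) by auto
        show ?thesis
        proof (cases "io \<in> G")
          case True
          \<comment> \<open>The processed \<open>io\<close> is charged with factor 2, which saves
            exactly one \<open>f io\<close>.\<close>
          let ?m = "\<lambda>i. if i = io then 2 else 3 :: real"
          have "sum (weight G) Co \<le> 3 * (\<Sum>j\<in>Co. d (\<sigma> j) j) + (\<Sum>i\<in>Fo. ?m i * g i)"
            using Co Fo True weight_le2[OF A, of io G] weight_le3[OF A]
            by (intro weight_sum_le) auto
          also have "(\<Sum>i\<in>Fo. ?m i * g i) = 3 * sum f Fo - f io"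
          proof -
            have "(\<Sum>i\<in>Fo. ?m i * g i) = 2 * f io + (\<Sum>i\<in>Fo - {io}. 3 * f i)"
              using fin Fo(2) gf by (subst sum.remove[of _ io]) (auto intro: sum.cong)
            moreover have "sum f Fo = f io + sum f (Fo - {io})" using fin Fo(2) by (intro sum.remove)
            ultimately show ?thesis by (simp add: sum_distrib_left)
          qed
          finally show ?thesis
            using service SP P_Co gH' gk sumf by (intro finish) (simp add: Z_def)
        next
          case False
          \<comment> \<open>Now \<open>r k \<le> r io\<close>, so clients served by
            \<open>io\<close> can be exchanged against clients near \<open>k\<close>. The cost is
            split into the part \<open>X\<close> due to \<open>io\<close> and the rest
            \<open>Y\<close>.\<close>
          define T where "T = {j \<in> Co. \<sigma> j = io}"
          have T: "T \<subseteq> Co" "finite T" using fin by (auto simp: T_def)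
          \<comment> \<open>The subtraction is truncated: if \<open>T\<close> is larger than
            \<open>P\<close>, then \<open>P'\<close> is empty. In either case \<open>P - P'\<close>
            has at most \<open>card T\<close> elements.\<close>
          have "card P - card T \<le> card P" by simp
          from ex_smallest_subset[OF finP this, of "weight G"]
          obtain P' where P': "P' \<subseteq> P" "card P' = card P - card T"
            "\<forall>a\<in>P'. \<forall>b\<in>P - P'. weight G a \<le> weight G b" by blast
          define X Y where "X = f io + (\<Sum>j\<in>T. d (\<sigma> j) j)"
            and "Y = sum f (Fo - {io}) + (\<Sum>j\<in>Co - T. d (\<sigma> j) j)"
          have Z: "Z = X + Y"
            using sum.remove[of Fo io f] sum.subset_diff[OF T(1) fin(2), of "\<lambda>j. d (\<sigma> j) j"] fin Fo(2)
            unfolding Z_def X_def Y_def by simp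
          have "sum (weight G) P' \<le> sum (weight G) (Co - T)"
          proof (rule sum_le_sum_exchange)
            show "finite P'" using P'(1) finP finite_subset by blast
            show "card P' \<le> card (Co - T)" using P'(2) P(3) Co(2) T by (simp add: card_Diff_subset)
            show "weight G a \<le> weight G b" if "a \<in> P' - (Co - T)" "b \<in> Co - T - P'" for a b
              using that P'(1,3) P_min[of a b] Co(1) by blast
          qed (use fin weight_nonneg[OF A] in auto)
          also have "\<dots> \<le> 3 * (\<Sum>j\<in>Co - T. d (\<sigma> j) j) + (\<Sum>i\<in>Fo - {io}. 3 * g i)"
            using Co Fo weight_le3[OF A] by (intro weight_sum_le) (auto simp: T_def)
          also have "(\<Sum>i\<in>Fo - {io}. 3 * g i) = 3 * sum f (Fo - {io})"
            using gf by (simp add: sum_distrib_left)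
          finally have wY: "sum (weight G) P' \<le> 3 * Y" by (simp add: Y_def)
          \<comment> \<open>Payment to \<open>io\<close> plus distance to \<open>io\<close> is at
            least \<open>r io\<close> for each client of \<open>T\<close>.\<close>
          have "f io + (\<Sum>j\<in>T. d (\<sigma> j) j) \<ge> real (card T) * r io"
          proof -
            have "f io = (\<Sum>j\<in>C. max 0 (r io - d io j))" using gf[OF Fo(2)] radius Fo by auto
            also have "\<dots> \<ge> (\<Sum>j\<in>T. max 0 (r io - d io j))"
              using T(1) Co(1) finite_C by (intro sum_mono2) auto
            finally have "f io + (\<Sum>j\<in>T. d io j) \<ge> (\<Sum>j\<in>T. max 0 (r io - d io j) + d io j)"
              by (simp add: sum.distrib)
            moreover have "(\<Sum>j\<in>T. max 0 (r io - d io j) + d io j) \<ge> (\<Sum>j\<in>T. r io)"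
              by (intro sum_mono) auto
            moreover have "(\<Sum>j\<in>T. d (\<sigma> j) j) = (\<Sum>j\<in>T. d io j)"
              by (intro sum.cong) (auto simp: T_def)
            ultimately show ?thesis by simp
          qed
          moreover have "real (card (P - P')) * r k \<le> real (card T) * r io"
          proof (rule mult_mono)
            have "card (P - P') = card P - card P'"
              using P'(1) finP finite_subset by (intro card_Diff_subset) blast+
            then show "real (card (P - P')) \<le> real (card T)" using P'(2) by simp
            show "r k \<le> r io" using greedy_invD(4)[OF inv', of io] False Fo by (cases "io = k") auto
            show "0 \<le> r k" using r_nonneg k by blast
          qed auto
          ultimately have qX: "real (card (P - P')) * r k \<le> X" unfolding X_def by linarith
          obtain S2 where S2: "S2 \<subseteq> C'" "card S2 = card P" and
            cost: "sum g H + sum ?D S2 \<le> sum (weight G) P' + 2 * (real (card (P - P')) * r k)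
              \<or> sum g H' + sum ?D S2 \<le> sum (weight G) P' + 3 * (real (card (P - P')) * r k)"
            using exchange_cost[OF inv inv'[unfolded H'k] k P(1) P(2)[unfolded C'(1)] P'(1)]
            unfolding C'(1) H'k by blast
          have SS: "sum ?D S \<le> sum ?D S2" using S[of S2] S2 P(3) C'C by blast
          have X: "f io \<le> X" unfolding X_def using dist0[of T] by simp
          have fiZ: "f io \<le> f ie" using f(2) Fo by blast
          show ?thesis
            using cost
          proof
            \<comment> \<open>\<open>X\<close> is charged only twice, and
              \<open>f io \<le> X\<close> is the saving; \<open>k\<close> is paid separately by
              \<open>gk\<close>.\<close>
            assume "sum g H + sum ?D S2 \<le> sum (weight G) P' + 2 * (real (card (P - P')) * r k)"
            then show ?thesis
              using SS sumf gH' gk wY qX X Z by (intro finish) linarith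
          next
            \<comment> \<open>The clients pay for \<open>k\<close> as well, so only one
              \<open>f ie\<close> remains; \<open>f io \<le> f ie\<close> fits it into the bound of
              \<open>finish\<close>.\<close>
            assume "sum g H' + sum ?D S2 \<le> sum (weight G) P' + 3 * (real (card (P - P')) * r k)"
            then show ?thesis
              using SS sumf wY qX X Z fiZ by (intro finish) linarith
          qed
        qed
      qed
    qed
  qed
qed

end

section \<open>From one iteration to the returned solution\<close>

context rfl_instance
begin

text \<open>This interprets \<open>radii\<close> for one iteration. The cost class is kept abstract:
  bounding every \<open>x\<close> in \<open>R\<close> by \<open>(1 + \<epsilon>) * f io\<close>
  treats the class of cost 0 and the geometric classes alike.\<close>

lemma rfl_round_bound:
  assumes round: "rfl_round F C d f p R Ct Ft"
  shows "rfl_feasible F C p Ct Ft"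
    and "rfl_feasible F C p Co Fo \<Longrightarrow> io \<in> Fo \<Longrightarrow> f io \<in> R \<Longrightarrow> \<forall>i\<in>Fo. f i \<le> f io \<Longrightarrow>
      \<forall>x\<in>R. x \<le> (1 + \<epsilon>) * f io \<Longrightarrow> 0 \<le> \<epsilon> \<Longrightarrow>
      rfl_cost d f Ct Ft \<le> (4 + 2 * \<epsilon>) * rfl_cost d f Co Fo"
proof -
  let ?l = "card C - p"
  obtain ie r xs C' O' where ie: "ie \<in> F" "f ie \<in> R" "\<forall>i\<in>F. f i \<in> R \<longrightarrow> f i \<le> f ie"
    and r: "\<forall>i\<in>F. modified_cost f ie i \<noteq> \<infinity> \<longrightarrow> is_radius C d f ie i (r i)"
    and xs: "distinct xs" "set xs = {i \<in> F. modified_cost f ie i \<noteq> \<infinity>}" "sorted (map r xs)"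
    and greedy: "greedy C d ?l r xs {} {} C {} = (C', Ft, O')"
    and outlier: "outlier_step d ?l Ft C' O' Ct"
    using round unfolding rfl_round_def by blast
  define A where "A = {i \<in> F. f i \<le> f ie}"
  define g where "g i = (if i = ie then 0 else f i)" for i
  have fin_cost: "modified_cost f ie i \<noteq> \<infinity> \<longleftrightarrow> f i \<le> f ie" for i
    by (auto simp: modified_cost_def zero_ereal_def)
  have rad: "0 \<le> r i" "g i = (\<Sum>j\<in>C. max 0 (r i - d i j))" if "i \<in> A" for i
    using r that fin_cost[of i] unfolding A_def is_radius_def g_def modified_cost_def
    by (auto simp: zero_ereal_def split: if_splits)
  interpret radii F C d A g r
    using finite_facilities finite_clients rad by unfold_locales (auto simp: A_def)
  have xsA: "set xs = A" using xs(2) fin_cost by (auto simp: A_def)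
  have ieA: "ie \<in> A" using ie(1) by (simp add: A_def)
  have inv0: "greedy_inv {} {} 0" using r_nonneg by (intro greedy_invI) auto
  have cov0: "cov {} 0 = {}" by (simp add: cov_def)
  have part: "C' \<subseteq> C" "O' = C - C'"
    using greedy greedy_partition[of C d ?l r xs "{}" "{}" "{}"] by simp_all
  have run: "(\<exists>\<rho>'. greedy_inv A Ft \<rho>' \<and> C' = cov A \<rho>' \<and> ?l \<le> card (C - C')) \<or>
    (\<exists>G H \<rho> k. greedy_inv G H \<rho> \<and> k \<in> A - G \<and> ?l \<le> card (C - cov G \<rho>) \<and>
       greedy_inv (insert k G) Ft (r k) \<and> (Ft = H \<or> Ft = insert k H) \<and>
       C' = cov (insert k G) (r k) \<and> card (C - C') \<le> ?l)"
    by (rule greedy_run[of ?l xs "{}" 0 "{}"])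
      (use greedy inv0 xs xsA in \<open>auto simp: cov0\<close>)
  have compl: "?l \<le> card (C - U) \<longleftrightarrow> card U \<le> p" "card (C - U) \<le> ?l \<longleftrightarrow> p \<le> card U" if "U \<subseteq> C" for U
  proof -
    have "finite U" "card U \<le> card C"
      using that finite_clients finite_subset card_mono by blast+
    then show "?l \<le> card (C - U) \<longleftrightarrow> card U \<le> p" "card (C - U) \<le> ?l \<longleftrightarrow> p \<le> card U"
      using that coverage_le by (auto simp: card_Diff_subset)
  qed
  have run': "(\<exists>\<rho>'. greedy_inv A Ft \<rho>' \<and> C' = cov A \<rho>' \<and> card C' \<le> p) \<or>
    (\<exists>G H \<rho> k. greedy_inv G H \<rho> \<and> k \<in> A - G \<and> card (cov G \<rho>) \<le> p \<and>
       greedy_inv (insert k G) Ft (r k) \<and> (Ft = H \<or> Ft = insert k H) \<and>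
       C' = cov (insert k G) (r k) \<and> p \<le> card C')"
    using run unfolding compl[OF part(1)] compl(1)[OF cov_subset] .
  \<comment> \<open>Since \<open>ie\<close> is kept, at least one facility is processed, and the
    invariant then provides an open one.\<close>
  obtain G' \<rho>' where G': "greedy_inv G' Ft \<rho>'" "G' \<noteq> {}"
    using run ieA by blast
  then have Ft: "Ft \<subseteq> A" "Ft \<noteq> {}" using greedy_invD(1,2,5)[OF G'(1)] by blast+
  have finFt: "finite Ft" by (rule finite_open[OF G'(1)])
  have D0: "0 \<le> dist_open d Ft j" for j
    unfolding dist_open_def using finFt Ft(2) by (subst Min_ge_iff) auto
  have lC: "?l \<le> card C" "card C - ?l = p" using coverage_le by auto
  note opt = outlier_step_optimal[OF outlier[unfolded part(2)] finite_clients part(1) lC(1) D0,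
      unfolded lC(2)]
  show "rfl_feasible F C p Ct Ft"
    using Ft A_subset opt(1,2) unfolding rfl_feasible_def by auto
  assume feas: "rfl_feasible F C p Co Fo" and io: "io \<in> Fo" "f io \<in> R" "\<forall>i\<in>Fo. f i \<le> f io"
    and R: "\<forall>x\<in>R. x \<le> (1 + \<epsilon>) * f io" and \<epsilon>: "0 \<le> \<epsilon>"
  have Fo: "Fo \<subseteq> F" "Co \<subseteq> C" "p \<le> card Co" using feas unfolding rfl_feasible_def by auto
  \<comment> \<open>As \<open>io\<close> lies in \<open>R\<close> and \<open>ie\<close> is most
    expensive there, no facility of the comparison solution is removed.\<close>
  have FoA: "Fo \<subseteq> A" using Fo(1) io ie(3) unfolding A_def by fastforce
  have finFo: "finite Fo" using Fo(1) finite_facilities finite_subset by blast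
  have "dist_open d Fo j \<in> (\<lambda>i. d i j) ` Fo" for j
    unfolding dist_open_def using finFo io(1) by (intro Min_in) auto
  then have "\<exists>i\<in>Fo. dist_open d Fo j = d i j" for j by blast
  then obtain \<sigma> where \<sigma>: "\<And>j. \<sigma> j \<in> Fo" "\<And>j. dist_open d Fo j = d (\<sigma> j) j" by metis
  have "sum f Ft + sum (dist_open d Ft) Ct \<le> (4 + 2 * \<epsilon>) * (sum f Fo + (\<Sum>j\<in>Co. d (\<sigma> j) j))"
  proof (rule total_cost[where ie = ie and io = io, OF _ _ _ FoA io(1) \<epsilon> _ ieA Fo(2,3) \<sigma>(1) run' opt(3)])
    show "f ie \<le> (1 + \<epsilon>) * f io" using R ie(2) by blast
  qed (auto simp: A_def g_def opening_cost_nonneg)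
  then show "rfl_cost d f Ct Ft \<le> (4 + 2 * \<epsilon>) * rfl_cost d f Co Fo"
    unfolding rfl_cost_def using \<sigma>(2) by simp
qed

end

theorem theorem11:
  fixes F C C' F' Copt Fopt :: "'a set"
    and d :: "'a \<Rightarrow> 'a \<Rightarrow> real" and f :: "'a \<Rightarrow> real"
    and p :: nat and \<epsilon> :: real and zr :: bool
  assumes "rfl_instance F C d f p"
    and "0 < \<epsilon>" and "\<epsilon> \<le> 1"
    and "robust_fac_loc F C d f p zr \<epsilon> C' F'"
    and "rfl_optimal F C d f p Copt Fopt"
    and "zr \<or> (\<exists>i\<in>Fopt. 0 < f i)"
  shows "rfl_feasible F C p C' F' \<and>
         rfl_cost d f C' F' \<le> (5 + \<epsilon>) * rfl_cost d f Copt Fopt"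
proof -
  interpret rfl_instance F C d f p by fact
  have feas: "rfl_feasible F C p Copt Fopt" using assms(5) unfolding rfl_optimal_def by blast
  then have Fopt: "Fopt \<subseteq> F" "Fopt \<noteq> {}" unfolding rfl_feasible_def by auto
  have fin: "finite Fopt" using Fopt(1) finite_facilities finite_subset by blast
  obtain io where io: "io \<in> Fopt" "\<forall>i\<in>Fopt. f i \<le> f io"
    using arg_min_if_finite[OF fin Fopt(2), of "\<lambda>i. - f i"] by (auto simp: not_less)
  have io0: "0 \<le> f io" using io(1) Fopt(1) opening_cost_nonneg by blast
  obtain s where s: "s \<in> rfl_iterations F f zr \<epsilon>" "f io \<in> cost_class \<epsilon> s"
    "\<forall>x\<in>cost_class \<epsilon> s. x \<le> (1 + \<epsilon>) * f io"
  proof (cases "f io = 0")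
    case True
    \<comment> \<open>All facilities of the optimum are free here, so the last assumption guarantees
      the iteration for cost 0.\<close>
    then have zr using assms(6) io(2) by force
    then have "None \<in> rfl_iterations F f zr \<epsilon>"
      using True io(1) Fopt(1) unfolding rfl_iterations_def by auto
    then show ?thesis using that[of None] True by simp
  next
    case False
    then obtain t where t: "f io \<in> cost_class \<epsilon> (Some t)"
      using ex_cost_class[OF assms(2), of "f io"] io0 by auto
    then have "Some t \<in> rfl_iterations F f zr \<epsilon>"
      using io(1) Fopt(1) unfolding rfl_iterations_def by blast
    moreover have "x \<le> (1 + \<epsilon>) * f io" if "x \<in> cost_class \<epsilon> (Some t)" for x
    proof -
      have "x \<le> (1 + \<epsilon>) * (1 + \<epsilon>) powi t"
        using that assms(2) by (simp add: power_int_add mult.commute)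
      also have "\<dots> \<le> (1 + \<epsilon>) * f io" using t assms(2) by (intro mult_left_mono) auto
      finally show ?thesis .
    qed
    ultimately show ?thesis using that[of "Some t"] t by blast
  qed
  obtain Ct Ft t where Ct: "\<forall>t \<in> rfl_iterations F f zr \<epsilon>.
      rfl_round F C d f p (cost_class \<epsilon> t) (Ct t) (Ft t)"
    and t: "t \<in> rfl_iterations F f zr \<epsilon>" "C' = Ct t" "F' = Ft t"
    and best: "\<forall>s \<in> rfl_iterations F f zr \<epsilon>.
      rfl_cost d f (Ct t) (Ft t) \<le> rfl_cost d f (Ct s) (Ft s)"
    using assms(4) unfolding robust_fac_loc_def by blast
  have cost_nonneg: "0 \<le> rfl_cost d f Copt Fopt"
    unfolding rfl_cost_def dist_open_def using fin Fopt opening_cost_nonneg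
    by (intro add_nonneg_nonneg sum_nonneg) (auto simp: subset_iff)
  have "rfl_cost d f C' F' \<le> rfl_cost d f (Ct s) (Ft s)" using best s(1) t by simp
  also have "\<dots> \<le> (4 + 2 * \<epsilon>) * rfl_cost d f Copt Fopt"
    using rfl_round_bound(2)[OF Ct[rule_format, OF s(1)] feas io(1) s(2) io(2) s(3)] assms(2) by simp
  also have "\<dots> \<le> (5 + \<epsilon>) * rfl_cost d f Copt Fopt"
    using assms(3) cost_nonneg by (intro mult_right_mono) auto
  finally show ?thesis using rfl_round_bound(1)[OF Ct[rule_format, OF t(1)]] t(2,3) by simp
qed

end
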